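(* Let $l\ge 2$ and let $u_1,\dots,u_l\in\mathbb{C}^2$, $u_j=(u_j^{(1)},u_j^{(2)})$, be row vectors of variables. Consider the space of polynomials in $(u_1,\dots,u_l)$ with the inner product in which monomials are pairwise orthogonal and $\|\prod_j (u_j^{(1)})^{a_j}(u_j^{(2)})^{b_j}\|^2=\prod_j a_j!\,b_j!$; the homogeneous component of multidegree $(n_1,\dots,n_l)$ (degree $n_j$ in $u_j$) is $V_{n_1}\otimes\cdots\otimes V_{n_l}$, on which $\mathrm{SU}(2)^l$ acts by $\big(\bigotimes_j T(A_j)\big)f(u_1,\dots,u_l)=f(u_1A_1,\dots,u_lA_l)$. For $i<j$ put $\xi_{ij}(u)=u_i^{(1)}u_j^{(2)}-u_i^{(2)}u_j^{(1)}$. For a symmetric $l\times l$ matrix $\alpha=(\alpha_{ij})$ of nonnegative integers with zero diagonal put $\Xi[\alpha]=\prod_{i<j}\xi_{ij}^{\alpha_{ij}}$, which lies in $V_{n_1}\otimes\cdots\otimes V_{n_l}$ with $n_i=\sum_j\alpha_{ij}$. For two such matrices $\alpha,\beta$ with $\sum_j\alpha_{ij}=\sum_j\beta_{ij}$ for all $i$, and $A_1,\dots,A_l\in\mathrm{SU}(2)$, put $$\Phi[\alpha,\beta](A_1,\dots,A_l)=\Big\langle \Big(\bigotimes_j T(A_j)\Big)\Xi[\alpha],\ \Xi[\beta]\Big\rangle .$$ For complex numbers $t_{ij}$ ($i<j$) let $T$ be the $2l\times 2l$ matrix composed of $2\times2$ blocks $T_{ij}$, where $T_{ij}=\begin{pmatrix}0&t_{ij}\\-t_{ij}&0\end{pmatrix}$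 for $i<j$, $T_{ii}=0$, $T_{ji}=-T_{ij}$; let $\overline{T'}$ be the analogous matrix built from the numbers $\overline{t'_{ij}}$; and let $U=\mathrm{diag}(A_1,\dots,A_l)$ (block diagonal). Then, for all $t_{ij},t'_{ij}$ sufficiently close to $0$ (with the branch of the square root equal to $1$ at $t=t'=0$), $$\sum_{n_1,\dots,n_l\ge 0}\ \sum_{\alpha:\,\sum_j\alpha_{ij}=n_i}\ \sum_{\beta:\,\sum_j\beta_{ij}=n_i}\ \Big(\prod_{i<j}\frac{t_{ij}^{\alpha_{ij}}\,\overline{t'_{ij}}^{\,\beta_{ij}}}{\alpha_{ij}!\,\beta_{ij}!}\Big)\Phi[\alpha,\beta](A_1,\dots,A_l)=\det\big(1-UTU^t\,\overline{T'}\big)^{-1/2},$$ where $\alpha,\beta$ range over symmetric nonnegative integer matrices with zero diagonal. *)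

theory Defs
  imports "HOL-Analysis.Analysis" "HOL-Library.Poly_Mapping"
    "Jordan_Normal_Form.Determinant" "Jordan_Normal_Form.Schur_Decomposition"
begin

(* Polynomials in the variables u_j^(k), indexed by (j,k) with j < l (0-based) and
   k \<in> {0,1} (k = 0 is the first coordinate u_j^(1), k = 1 the second u_j^(2)).
   A polynomial is a finitely supported map from monomials (exponent vectors) to
   coefficients. *)
type_synonym var = "nat \<times> nat"
type_synonym mono = "var \<Rightarrow>\<^sub>0 nat"
type_synonym cpoly = "mono \<Rightarrow>\<^sub>0 complex"

definition Var :: "var \<Rightarrow> cpoly" where
  "Var v = Poly_Mapping.single (Poly_Mapping.single v 1) 1"

definition Const :: "complex \<Rightarrow> cpoly" where
  "Const c = Poly_Mapping.single 0 c"

definition subst :: "(var \<Rightarrow> cpoly) \<Rightarrow> cpoly \<Rightarrow> cpoly" where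
  "subst \<sigma> f = (\<Sum>(m::mono)\<in>Poly_Mapping.keys f. Const (Poly_Mapping.lookup f m) *
                    (\<Prod>(v::var)\<in>Poly_Mapping.keys m. \<sigma> v ^ Poly_Mapping.lookup m v))"

definition mono_fact :: "mono \<Rightarrow> nat" where
  "mono_fact m = (\<Prod>v\<in>Poly_Mapping.keys m. fact (Poly_Mapping.lookup m v))"

definition fock_inner :: "cpoly \<Rightarrow> cpoly \<Rightarrow> complex" where
  "fock_inner f g = (\<Sum>m\<in>Poly_Mapping.keys f \<union> Poly_Mapping.keys g.
       Poly_Mapping.lookup f m * cnj (Poly_Mapping.lookup g m) * of_nat (mono_fact m))"

definition SU2 :: "complex mat \<Rightarrow> bool" where
  "SU2 A \<longleftrightarrow> A \<in> carrier_mat 2 2 \<and> A * mat_adjoint A = 1\<^sub>m 2 \<and> det A = 1"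

(* action (\<Otimes>_j T(A_j)) f (u_1,..,u_l) = f(u_1 A_1, ..., u_l A_l):
   u_j^(k) is replaced by (u_j A_j)^(k) = \<Sum>_m u_j^(m) (A_j)_{m k} *)
definition Tact :: "(nat \<Rightarrow> complex mat) \<Rightarrow> cpoly \<Rightarrow> cpoly" where
  "Tact A f = subst (\<lambda>(j,k). \<Sum>m<2. Const (A j $$ (m,k)) * Var (j,m)) f"

definition xi :: "nat \<Rightarrow> nat \<Rightarrow> cpoly" where
  "xi i j = Var (i,0) * Var (j,1) - Var (i,1) * Var (j,0)"

definition sym_mats :: "nat \<Rightarrow> (nat \<Rightarrow> nat \<Rightarrow> nat) set" where
  "sym_mats l = {\<alpha>. (\<forall>i j. \<alpha> i j = \<alpha> j i) \<and> (\<forall>i. \<alpha> i i = 0) \<and>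
                    (\<forall>i j. l \<le> i \<or> l \<le> j \<longrightarrow> \<alpha> i j = 0)}"

definition row_sum :: "nat \<Rightarrow> (nat \<Rightarrow> nat \<Rightarrow> nat) \<Rightarrow> nat \<Rightarrow> nat" where
  "row_sum l \<alpha> i = (\<Sum>j<l. \<alpha> i j)"

definition Xi :: "nat \<Rightarrow> (nat \<Rightarrow> nat \<Rightarrow> nat) \<Rightarrow> cpoly" where
  "Xi l \<alpha> = (\<Prod>(i,j)\<in>{(i,j). i < j \<and> j < l}. xi i j ^ \<alpha> i j)"

definition Phi :: "nat \<Rightarrow> (nat \<Rightarrow> nat \<Rightarrow> nat) \<Rightarrow> (nat \<Rightarrow> nat \<Rightarrow> nat) \<Rightarrow>
                   (nat \<Rightarrow> complex mat) \<Rightarrow> complex" where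
  "Phi l \<alpha> \<beta> A = fock_inner (Tact A (Xi l \<alpha>)) (Xi l \<beta>)"

definition blk :: "complex \<Rightarrow> nat \<Rightarrow> nat \<Rightarrow> complex" where
  "blk s a b = (if a = 0 \<and> b = 1 then s else if a = 1 \<and> b = 0 then - s else 0)"

definition Tmat :: "nat \<Rightarrow> (nat \<Rightarrow> nat \<Rightarrow> complex) \<Rightarrow> complex mat" where
  "Tmat l t = mat (2*l) (2*l) (\<lambda>(r,c).
      if r div 2 < c div 2 then blk (t (r div 2) (c div 2)) (r mod 2) (c mod 2)
      else if c div 2 < r div 2 then - blk (t (c div 2) (r div 2)) (r mod 2) (c mod 2)
      else 0)"

definition Umat :: "nat \<Rightarrow> (nat \<Rightarrow> complex mat) \<Rightarrow> complex mat" where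
  "Umat l A = mat (2*l) (2*l) (\<lambda>(r,c).
      if r div 2 = c div 2 then A (r div 2) $$ (r mod 2, c mod 2) else 0)"

end

theory Submission
  imports Defs
begin

text \<open>
  The generating function of the \<open>\<Xi>[\<alpha>]\<close> is the Gaussian \<open>exp (u T u\<^sup>t / 2)\<close>, and the action of \<open>U\<close>
  replaces \<open>T\<close> by \<open>S = U T U\<^sup>t\<close>. So the series is \<open>G(1)\<close> for
  \<open>G(s) = \<langle>exp (s u S u\<^sup>t / 2), exp (u T' u\<^sup>t / 2)\<rangle>\<close>. Multiplication by \<open>u\<^sub>a\<close> is adjoint to \<open>\<partial>\<^sub>a\<close>, so
  with \<open>R\<close> the conjugate of \<open>T'\<close> the second moments
  \<open>M\<^sub>a\<^sub>b(s) = \<langle>u\<^sub>a u\<^sub>b exp (s u S u\<^sup>t / 2), exp (u T' u\<^sup>t / 2)\<rangle>\<close> satisfy \<open>M (1 - s S R) = G R\<close>, while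
  \<open>2 G' = tr (S M)\<close>. By Jacobi's formula for \<open>D(s) = det (1 - s S R)\<close> this gives \<open>2 G' D = - G D'\<close>,
  that is, \<open>G\<^sup>2 D = 1\<close> as formal power series in \<open>s\<close>. For small \<open>t, t'\<close> everything converges
  absolutely and \<open>|G(1) - 1| < 1\<close>, which selects the branch of the square root.
\<close>

subsection \<open>Polynomials as sums of monomials\<close>

lemma poly_mapping_sum_single:
  fixes f :: "'a \<Rightarrow>\<^sub>0 'b::comm_monoid_add"
  shows "f = (\<Sum>m\<in>Poly_Mapping.keys f. Poly_Mapping.single m (Poly_Mapping.lookup f m))"
proof (rule poly_mapping_eqI)
  fix k
  have "(\<Sum>m\<in>Poly_Mapping.keys f. Poly_Mapping.lookup (Poly_Mapping.single m (Poly_Mapping.lookup f m)) k)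
      = (\<Sum>m\<in>Poly_Mapping.keys f. if m = k then Poly_Mapping.lookup f k else 0)"
    by (intro sum.cong refl) (auto simp: lookup_single when_def)
  also have "\<dots> = Poly_Mapping.lookup f k"
    by (simp add: in_keys_iff)
  finally show "Poly_Mapping.lookup f k =
      Poly_Mapping.lookup (\<Sum>m\<in>Poly_Mapping.keys f. Poly_Mapping.single m (Poly_Mapping.lookup f m)) k"
    by (simp add: lookup_sum)
qed

text \<open>A polynomial is a finite sum of terms, so an additively closed property only has to be
  checked on single terms. Linear and bilinear identities are reduced to monomials in this
  way.\<close>

lemma poly_mapping_single_induct [case_names single add]:
  fixes f :: "'a \<Rightarrow>\<^sub>0 'b::comm_monoid_add"
  assumes single: "\<And>m c. P (Poly_Mapping.single m c)"
    and add: "\<And>f g. P f \<Longrightarrow> P g \<Longrightarrow> P (f + g)"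
  shows "P f"
proof -
  have "P (\<Sum>m\<in>K. Poly_Mapping.single m (Poly_Mapping.lookup f m))" if "finite K" for K
    using that
  proof (induction K rule: finite_induct)
    case empty
    \<comment> \<open>The empty sum is a term with coefficient 0, at an arbitrary monomial.\<close>
    show ?case using single[of undefined 0] by simp
  qed (simp add: single add)
  from this[OF finite_keys[of f]] show ?thesis
    by (simp flip: poly_mapping_sum_single)
qed

lemma Const_0 [simp]: "Const 0 = 0"
  and Const_1 [simp]: "Const 1 = 1"
  and Const_add: "Const (a + b) = Const a + Const b"
  and Const_uminus: "Const (- a) = - Const a"
  and Const_mult: "Const (a * b) = Const a * Const b"
  and Const_of_nat: "Const (of_nat n) = of_nat n"
  by (simp_all add: Const_def single_add single_uminus mult_single)

lemma Const_power: "Const (a ^ n) = Const a ^ n"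
  by (induction n) (simp_all add: Const_mult)

lemma Const_sum: "Const (sum f I) = (\<Sum>i\<in>I. Const (f i))"
  by (induction I rule: infinite_finite_induct) (simp_all add: Const_add)

lemma Const_prod: "Const (prod f I) = (\<Prod>i\<in>I. Const (f i))"
  by (induction I rule: infinite_finite_induct) (simp_all add: Const_mult)

lemma Const_times_single: "Const c * Poly_Mapping.single m d = Poly_Mapping.single m (c * d)"
  by (simp add: Const_def mult_single)

lemma Var_times_single:
  "Var v * Poly_Mapping.single m d = Poly_Mapping.single (Poly_Mapping.single v 1 + m) d"
  by (simp add: Var_def mult_single)

subsection \<open>The Fock inner product\<close>

text \<open>Summing over the monomials of \<open>f\<close> alone makes additivity in the first
  argument a case of \<open>setsum_keys_plus_distrib\<close>; conjugate symmetry then transfers it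
  to the second argument.\<close>

lemma fock_inner_left:
  "fock_inner f g = (\<Sum>m\<in>Poly_Mapping.keys f.
     Poly_Mapping.lookup f m * cnj (Poly_Mapping.lookup g m) * of_nat (mono_fact m))"
  unfolding fock_inner_def
  by (rule sum.mono_neutral_right) (auto simp: in_keys_iff)

lemma fock_inner_commute: "fock_inner g f = cnj (fock_inner f g)"
  unfolding fock_inner_def by (simp add: cnj_sum Un_commute mult_ac)

lemma fock_inner_add_left: "fock_inner (f + g) h = fock_inner f h + fock_inner g h"
  unfolding fock_inner_left
  by (rule setsum_keys_plus_distrib) (simp_all add: algebra_simps)

lemma fock_inner_add_right: "fock_inner h (f + g) = fock_inner h f + fock_inner h g"
  by (metis complex_cnj_add fock_inner_add_left fock_inner_commute)

lemma fock_inner_0_left [simp]: "fock_inner 0 g = 0"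
  by (simp add: fock_inner_left)

lemma fock_inner_0_right [simp]: "fock_inner g 0 = 0"
  by (metis complex_cnj_zero fock_inner_0_left fock_inner_commute)

lemma fock_inner_sum_left: "fock_inner (sum f I) h = (\<Sum>i\<in>I. fock_inner (f i) h)"
  by (induction I rule: infinite_finite_induct) (simp_all add: fock_inner_add_left)

lemma fock_inner_sum_right: "fock_inner h (sum f I) = (\<Sum>i\<in>I. fock_inner h (f i))"
  by (induction I rule: infinite_finite_induct) (simp_all add: fock_inner_add_right)

lemma fock_inner_single:
  "fock_inner (Poly_Mapping.single m c) (Poly_Mapping.single n d) =
     (if m = n then c * cnj d * of_nat (mono_fact m) else 0)"
  by (auto simp: fock_inner_left lookup_single when_def)

lemma fock_inner_Const_left: "fock_inner (Const c * f) g = c * fock_inner f g"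
proof (induction f rule: poly_mapping_single_induct)
  case (single m d)
  show ?case
    by (induction g rule: poly_mapping_single_induct)
       (simp_all add: Const_times_single fock_inner_single fock_inner_add_right algebra_simps)
qed (simp add: fock_inner_add_left algebra_simps)

lemma fock_inner_Const_right: "fock_inner f (Const c * g) = cnj c * fock_inner f g"
  by (metis complex_cnj_mult fock_inner_Const_left fock_inner_commute)

subsection \<open>Partial derivatives\<close>

text \<open>The subtraction of exponents is truncated; when \<open>v\<close> does not occur in
  \<open>m\<close>, the factor \<open>lookup m v\<close> is 0 and removes the term.\<close>

definition pdiff :: "var \<Rightarrow> cpoly \<Rightarrow> cpoly" where
  "pdiff v f = (\<Sum>m\<in>Poly_Mapping.keys f. Poly_Mapping.single (m - Poly_Mapping.single v 1)
      (Poly_Mapping.lookup f m * of_nat (Poly_Mapping.lookup m v)))"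

lemma pdiff_add: "pdiff v (f + g) = pdiff v f + pdiff v g"
  unfolding pdiff_def
  by (rule setsum_keys_plus_distrib) (simp_all add: algebra_simps single_add)

lemma pdiff_0 [simp]: "pdiff v 0 = 0"
  by (simp add: pdiff_def)

lemma pdiff_sum: "pdiff v (sum f I) = (\<Sum>i\<in>I. pdiff v (f i))"
  by (induction I rule: infinite_finite_induct) (simp_all add: pdiff_add)

lemma pdiff_single: "pdiff v (Poly_Mapping.single m c) =
    Poly_Mapping.single (m - Poly_Mapping.single v 1) (c * of_nat (Poly_Mapping.lookup m v))"
  by (simp add: pdiff_def)

lemma pdiff_Const_mult: "pdiff v (Const c * f) = Const c * pdiff v f"
  by (induction f rule: poly_mapping_single_induct)
     (simp_all add: pdiff_single Const_times_single pdiff_add algebra_simps)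

text \<open>This is the canonical commutation relation. It serves as the product rule for quadratic
  forms, whose terms are built up one variable at a time.\<close>

lemma pdiff_Var_mult:
  "pdiff v (Var w * f) = (if v = w then f else 0) + Var w * pdiff v f"
proof (induction f rule: poly_mapping_single_induct)
  case (single m c)
  let ?e = "\<lambda>v. Poly_Mapping.single v (1::nat)"
  show ?case
  \<comment> \<open>The truncated subtraction of \<open>?e v\<close> commutes with adding
    \<open>?e w\<close> once \<open>v\<close> occurs in \<open>m\<close>; otherwise the derivative
    of the term is 0.\<close>
  proof (cases "Poly_Mapping.lookup m v = 0")
    case True
    have "?e v + m - ?e v = m"
      by (rule poly_mapping_eqI) (simp add: lookup_add lookup_minus)
    then show ?thesis
      using True
      by (auto simp: Var_times_single pdiff_single lookup_add lookup_single when_def)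
  next
    case False
    have "?e w + m - ?e v = ?e w + (m - ?e v)"
      by (rule poly_mapping_eqI)
         (use False in \<open>auto simp: lookup_add lookup_minus lookup_single when_def\<close>)
    moreover have "?e v + (m - ?e v) = m"
      by (rule poly_mapping_eqI)
         (use False in \<open>auto simp: lookup_add lookup_minus lookup_single when_def\<close>)
    ultimately show ?thesis
      by (auto simp: Var_times_single pdiff_single lookup_add lookup_single when_def
            single_add algebra_simps)
  qed
qed (simp add: pdiff_add algebra_simps)

lemma mono_fact_superset:
  assumes "finite K" "Poly_Mapping.keys m \<subseteq> K"
  shows "mono_fact m = (\<Prod>v\<in>K. fact (Poly_Mapping.lookup m v))"
  unfolding mono_fact_def using assms
  by (intro prod.mono_neutral_left) (auto simp: in_keys_iff)

lemma mono_fact_single_add: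
  "mono_fact (Poly_Mapping.single v 1 + m) = (Poly_Mapping.lookup m v + 1) * mono_fact m"
proof -
  let ?K = "insert v (Poly_Mapping.keys m)" and ?m = "Poly_Mapping.single v 1 + m"
  have "mono_fact ?m = (\<Prod>w\<in>?K. fact (Poly_Mapping.lookup ?m w))"
    by (rule mono_fact_superset)
       (auto simp: in_keys_iff lookup_add lookup_single when_def split: if_splits)
  also have "\<dots> = fact (Poly_Mapping.lookup m v + 1) *
      (\<Prod>w\<in>?K - {v}. fact (Poly_Mapping.lookup ?m w))"
    by (subst prod.remove[of _ v]) (auto simp: lookup_add)
  also have "(\<Prod>w\<in>?K - {v}. fact (Poly_Mapping.lookup ?m w)) =
      (\<Prod>w\<in>?K - {v}. fact (Poly_Mapping.lookup m w) :: nat)"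
    by (rule prod.cong) (auto simp: lookup_add lookup_single when_def)
  also have "fact (Poly_Mapping.lookup m v + 1) * \<dots> =
      (Poly_Mapping.lookup m v + 1) * (\<Prod>w\<in>?K. fact (Poly_Mapping.lookup m w))"
    by (subst prod.remove[of ?K v]) (auto simp: algebra_simps)
  also have "(\<Prod>w\<in>?K. fact (Poly_Mapping.lookup m w)) = mono_fact m"
    by (rule mono_fact_superset[symmetric]) auto
  finally show ?thesis .
qed

text \<open>Raising the exponent a of a variable to a + 1 multiplies the factorial weight by a + 1,
  exactly the factor that differentiation produces. All moment identities rest on this
  adjointness.\<close>

lemma fock_inner_Var_left: "fock_inner (Var v * f) g = fock_inner f (pdiff v g)"
proof (induction f rule: poly_mapping_single_induct)
  case f: (single m c)
  show ?case
  proof (induction g rule: poly_mapping_single_induct)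
    case (single n d)
    let ?e = "Poly_Mapping.single v (1::nat)"
    consider "Poly_Mapping.lookup n v = 0" | "Poly_Mapping.lookup n v \<noteq> 0" by blast
    then show ?case
    proof cases
      \<comment> \<open>If \<open>v\<close> is absent from \<open>n\<close>, the derivative is 0,
        and no monomial containing \<open>v\<close> equals \<open>n\<close>.\<close>
      case 1
      then have "?e + m \<noteq> n"
        by (auto simp: lookup_add)
      with 1 show ?thesis
        by (simp add: Var_times_single pdiff_single fock_inner_single)
    next
      case 2
      have n: "?e + (n - ?e) = n"
        by (rule poly_mapping_eqI)
           (use 2 in \<open>auto simp: lookup_add lookup_minus lookup_single when_def\<close>)
      then have "?e + m = n \<longleftrightarrow> m = n - ?e"
        by (metis add_left_imp_eq)
      moreover have "mono_fact n = Poly_Mapping.lookup n v * mono_fact (n - ?e)"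
        using mono_fact_single_add[of v "n - ?e"] n 2 by (simp add: lookup_minus)
      ultimately show ?thesis
        by (auto simp: Var_times_single pdiff_single fock_inner_single)
    qed
  qed (simp add: pdiff_add fock_inner_add_right)
qed (simp add: fock_inner_add_left algebra_simps)

lemma fock_inner_Var_right: "fock_inner f (Var v * g) = fock_inner (pdiff v f) g"
  by (metis fock_inner_Var_left fock_inner_commute)

subsection \<open>Jacobi's formula and determinants of power series matrices\<close>

lemma derivation_prod:
  fixes d :: "'a::comm_ring_1 \<Rightarrow> 'a"
  assumes "\<And>x y. d (x * y) = d x * y + x * d y"
    and "finite I"
  shows "d (prod f I) = (\<Sum>k\<in>I. d (f k) * prod f (I - {k}))"
  using assms(2)
proof (induction I rule: finite_induct)
  case empty
  show ?case using assms(1)[of 1 1] by simp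
next
  case (insert i I)
  have "d (prod f (insert i I)) = d (f i) * prod f I + (\<Sum>k\<in>I. d (f k) * (f i * prod f (I - {k})))"
    using insert by (simp add: assms(1) sum_distrib_left mult_ac)
  also have "(\<Sum>k\<in>I. d (f k) * (f i * prod f (I - {k}))) =
      (\<Sum>k\<in>I. d (f k) * prod f (insert i I - {k}))"
    using insert by (intro sum.cong refl) (auto simp: insert_Diff_if)
  finally show ?case
    using insert by simp
qed

text \<open>The product rule differentiates one row at a time in every summand of the permutation
  expansion; expanding along that row yields the cofactors. A general derivation \<open>d\<close>
  covers \<open>fps_deriv\<close>.\<close>

lemma derivation_det:
  fixes d :: "'a::comm_ring_1 \<Rightarrow> 'a"
  assumes add: "\<And>x y. d (x + y) = d x + d y"
    and mult: "\<And>x y. d (x * y) = d x * y + x * d y"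
    and A: "A \<in> carrier_mat n n"
  shows "d (det A) = (\<Sum>k<n. \<Sum>j<n. d (A $$ (k,j)) * cofactor A k j)"
proof -
  \<comment> \<open>\<open>B k\<close> is \<open>A\<close> with the derivation applied to row k
    only.\<close>
  define B where "B k = mat n n (\<lambda>(i,j). if i = k then d (A $$ (k,j)) else A $$ (i,j))" for k
  have B: "B k \<in> carrier_mat n n" for k by (simp add: B_def)
  have d0: "d 0 = 0" using add[of 0 0] by simp
  have d1: "d 1 = 0" using mult[of 1 1] by simp
  have d_uminus: "d (- x) = - d x" for x
    using add[of "-x" x] d0 by (simp add: eq_neg_iff_add_eq_0)
  have d_sum: "d (sum f I) = (\<Sum>i\<in>I. d (f i))" for f and I :: "'c set"
    by (induction I rule: infinite_finite_induct) (simp_all add: d0 add)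
  have d_sign: "d (signof p * x) = signof p * d x" for p :: "nat \<Rightarrow> nat" and x
    by (cases p rule: sign_cases) (simp_all add: d_uminus)
  have "d (det A) = (\<Sum>p | p permutes {0..<n}. signof p *
      (\<Sum>k<n. d (A $$ (k, p k)) * (\<Prod>i\<in>{0..<n} - {k}. A $$ (i, p i))))"
    unfolding det_def'[OF A] d_sum d_sign
    by (subst derivation_prod[OF mult]) (simp_all add: lessThan_atLeast0)
  also have "\<dots> = (\<Sum>k<n. \<Sum>p | p permutes {0..<n}. signof p *
      (d (A $$ (k, p k)) * (\<Prod>i\<in>{0..<n} - {k}. A $$ (i, p i))))"
    unfolding sum_distrib_left by (rule sum.swap)
  also have "\<dots> = (\<Sum>k<n. det (B k))"
  proof (rule sum.cong[OF refl])
    fix k assume "k \<in> {..<n}"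
    then have k: "k \<in> {0..<n}" by simp
    show "(\<Sum>p | p permutes {0..<n}. signof p *
      (d (A $$ (k, p k)) * (\<Prod>i\<in>{0..<n} - {k}. A $$ (i, p i)))) = det (B k)"
      unfolding det_def'[OF B]
    proof (rule sum.cong[OF refl])
      fix p assume "p \<in> {p. p permutes {0..<n}}"
      then have p: "p i < n" if "i < n" for i
        using that permutes_in_image[of p "{0..<n}" i] by auto
      have "(\<Prod>i\<in>{0..<n} - {k}. B k $$ (i, p i)) = (\<Prod>i\<in>{0..<n} - {k}. A $$ (i, p i))"
        by (rule prod.cong) (auto simp: B_def p)
      moreover have "B k $$ (k, p k) = d (A $$ (k, p k))"
        using k p by (simp add: B_def)
      ultimately show "signof p * (d (A $$ (k, p k)) * (\<Prod>i\<in>{0..<n} - {k}. A $$ (i, p i)))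
          = signof p * (\<Prod>i = 0..<n. B k $$ (i, p i))"
        using k by (subst prod.remove[of _ k]) auto
    qed
  qed
  also have "\<dots> = (\<Sum>k<n. \<Sum>j<n. d (A $$ (k,j)) * cofactor A k j)"
  proof (rule sum.cong[OF refl])
    fix k assume k: "k \<in> {..<n}"
    \<comment> \<open>Row k, the only row in which \<open>B k\<close> and \<open>A\<close> differ,
      is deleted.\<close>
    have "mat_delete (B k) k j = mat_delete A k j" for j
      using A by (intro eq_matI) (auto simp: B_def mat_delete_def)
    then have "cofactor (B k) k j = cofactor A k j" for j
      by (simp add: cofactor_def)
    moreover have "B k $$ (k, j) = d (A $$ (k,j))" if "j < n" for j
      using k that by (simp add: B_def)
    ultimately show "det (B k) = (\<Sum>j<n. d (A $$ (k,j)) * cofactor A k j)"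
      using k by (subst laplace_expansion_row[OF B, of k]) auto
  qed
  finally show ?thesis .
qed

text \<open>The determinant is taken once over the polynomial ring. Embedding into power series and
  evaluating at z are ring homomorphisms, hence commute with \<open>det\<close>; this links the
  formal identity to numbers.\<close>

lemma det_one_minus_fps_X:
  fixes K :: "complex mat"
  assumes "K \<in> carrier_mat n n"
  shows "\<exists>p. det (1\<^sub>m n - fps_X \<cdot>\<^sub>m map_mat fps_const K) = fps_of_poly p \<and>
             (\<forall>z. poly p z = det (1\<^sub>m n - z \<cdot>\<^sub>m K))"
proof -
  let ?P = "1\<^sub>m n - [:0,1:] \<cdot>\<^sub>m map_mat (\<lambda>c. [:c:]) K"
  interpret fp: comm_ring_hom "fps_of_poly :: complex poly \<Rightarrow> complex fps"
    by standard (simp_all add: fps_of_poly_add fps_of_poly_mult)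
  have "map_mat fps_of_poly ?P = 1\<^sub>m n - fps_X \<cdot>\<^sub>m map_mat fps_const K"
    using assms by (intro eq_matI)
      (auto simp: fps_of_poly_diff fps_of_poly_mult fps_of_poly_const fps_of_poly_fps_X
         fps_of_poly_pCons)
  then have 1: "det (1\<^sub>m n - fps_X \<cdot>\<^sub>m map_mat fps_const K) = fps_of_poly (det ?P)"
    by (metis fp.hom_det)
  have 2: "poly (det ?P) z = det (1\<^sub>m n - z \<cdot>\<^sub>m K)" for z
  proof -
    have ev: "comm_ring_hom (\<lambda>p. poly p z)"
      by standard simp_all
    have "map_mat (\<lambda>p. poly p z) ?P = 1\<^sub>m n - z \<cdot>\<^sub>m K"
      using assms by (intro eq_matI) auto
    then show ?thesis by (metis comm_ring_hom.hom_det[OF ev])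
  qed
  from 1 2 show ?thesis by blast
qed

text \<open>The adjugate \<open>Y\<close> of \<open>X\<close> takes the place of an inverse: the
  moment equation becomes \<open>D \<cdot>\<^sub>m M = G \<cdot>\<^sub>m (Rf * Y)\<close>, whose
  trace against \<open>S\<close> is compared with Jacobi's formula for \<open>D\<close>.\<close>

lemma fps_square_det_eq_1:
  fixes n :: nat and G :: "complex fps" and S R :: "complex mat" and M :: "complex fps mat"
  defines "SR \<equiv> map_mat fps_const (S * R)"
  defines "D \<equiv> det (1\<^sub>m n - fps_X \<cdot>\<^sub>m SR)"
  assumes S: "S \<in> carrier_mat n n" and R: "R \<in> carrier_mat n n" and M: "M \<in> carrier_mat n n"
    and eqM: "M * (1\<^sub>m n - fps_X \<cdot>\<^sub>m SR) = G \<cdot>\<^sub>m map_mat fps_const R"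
    and eqG: "2 * fps_deriv G = (\<Sum>a<n. (map_mat fps_const S * M) $$ (a,a))"
    and G0: "fps_nth G 0 = 1"
  shows "G ^ 2 * D = 1"
proof -
  interpret fc: comm_ring_hom "fps_const :: complex \<Rightarrow> complex fps"
    by standard simp_all
  define Sf where "Sf = map_mat fps_const S"
  define Rf where "Rf = map_mat fps_const R"
  define X where "X = 1\<^sub>m n - fps_X \<cdot>\<^sub>m SR"
  define Y where "Y = adj_mat X"
  have Sf: "Sf \<in> carrier_mat n n" and Rf: "Rf \<in> carrier_mat n n"
    using S R by (simp_all add: Sf_def Rf_def)
  have SR: "SR \<in> carrier_mat n n" using S R by (simp add: SR_def)
  have SR_eq: "SR = Sf * Rf"
    unfolding SR_def Sf_def Rf_def by (rule fc.mat_hom_mult[OF S R])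
  have X: "X \<in> carrier_mat n n" using SR unfolding X_def by (simp add: minus_carrier_mat)
  have Y: "Y \<in> carrier_mat n n" and XY: "X * Y = D \<cdot>\<^sub>m 1\<^sub>m n"
    using adj_mat[OF X] by (simp_all add: Y_def D_def X_def)
  have "D \<cdot>\<^sub>m M = M * (X * Y)"
    unfolding XY using M mult_smult_distrib[OF M one_carrier_mat] by simp
  also have "\<dots> = G \<cdot>\<^sub>m Rf * Y"
    using assoc_mult_mat[OF M X Y] eqM by (simp add: X_def Rf_def)
  finally have DM: "D \<cdot>\<^sub>m M = G \<cdot>\<^sub>m (Rf * Y)"
    using Rf Y by (simp add: mult_smult_assoc_mat)
  have "D \<cdot>\<^sub>m (Sf * M) = Sf * (D \<cdot>\<^sub>m M)"
    using mult_smult_distrib[OF Sf M] by simp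
  also have "\<dots> = G \<cdot>\<^sub>m (SR * Y)"
    unfolding DM SR_eq using mult_smult_distrib[OF Sf mult_carrier_mat[OF Rf Y]]
    by (simp add: assoc_mult_mat[OF Sf Rf Y])
  finally have DSM: "D \<cdot>\<^sub>m (Sf * M) = G \<cdot>\<^sub>m (SR * Y)" .
  have "2 * fps_deriv G * D = (\<Sum>a<n. (D \<cdot>\<^sub>m (Sf * M)) $$ (a,a))"
    using Sf M unfolding eqG Sf_def[symmetric] by (simp add: sum_distrib_left mult_ac)
  also have "\<dots> = G * (\<Sum>a<n. (SR * Y) $$ (a,a))"
    using SR Y unfolding DSM by (simp add: sum_distrib_left)
  finally have 1: "2 * fps_deriv G * D = G * (\<Sum>a<n. (SR * Y) $$ (a,a))" .
  \<comment> \<open>The entries of \<open>X\<close> have derivative minus those of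
    \<open>SR\<close>, and the cofactors are the transposed entries of \<open>Y\<close>, so Jacobi's
    formula gives minus the same trace.\<close>
  have "fps_deriv D = (\<Sum>k<n. \<Sum>j<n. fps_deriv (X $$ (k,j)) * cofactor X k j)"
    unfolding D_def X_def[symmetric]
    by (rule derivation_det[OF _ _ X]) (simp_all add: algebra_simps)
  also have "\<dots> = (\<Sum>k<n. - (SR * Y) $$ (k,k))"
  proof (rule sum.cong[OF refl])
    fix k assume k: "k \<in> {..<n}"
    have "fps_deriv (X $$ (k,j)) * cofactor X k j = - (SR $$ (k,j) * Y $$ (j,k))" if "j < n" for j
      using that k X S R by (simp add: X_def SR_def Y_def adj_mat_def del: fps_const_neg)
    then show "(\<Sum>j<n. fps_deriv (X $$ (k,j)) * cofactor X k j) = - (SR * Y) $$ (k,k)"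
      using k SR Y by (simp add: scalar_prod_def sum_negf lessThan_atLeast0)
  qed
  finally have 2: "fps_deriv D = - (\<Sum>a<n. (SR * Y) $$ (a,a))"
    by (simp add: sum_negf)
  have "fps_deriv (G ^ 2 * D) = G * (2 * fps_deriv G * D) + G ^ 2 * fps_deriv D"
    by (simp add: power2_eq_square algebra_simps)
  also have "\<dots> = 0"
    unfolding 1 2 by (simp add: power2_eq_square algebra_simps)
  \<comment> \<open>In characteristic 0 a vanishing derivative leaves only the constant term, and
    both \<open>G\<close> and \<open>D\<close> have constant term 1.\<close>
  finally have "G ^ 2 * D = fps_const (fps_nth (G ^ 2 * D) 0)"
    using fps_deriv_eq_0_iff by blast
  moreover have "fps_nth D 0 = 1"
  proof -
    obtain p where p: "D = fps_of_poly p" "\<And>z. poly p z = det (1\<^sub>m n - z \<cdot>\<^sub>m (S * R))"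
      using det_one_minus_fps_X[of "S * R" n] S R unfolding D_def SR_def by auto
    have "1\<^sub>m n - 0 \<cdot>\<^sub>m (S * R) = 1\<^sub>m n"
      using S R by (intro eq_matI) auto
    with p(2)[of 0] p(1) show ?thesis by (simp add: poly_0_coeff_0)
  qed
  ultimately show ?thesis
    using G0 by (simp add: power2_eq_square)
qed

subsection \<open>Gaussian pairings\<close>

text \<open>This is \<open>u S u^t / 2\<close> with \<open>u_a = Var (v a)\<close>; \<open>v\<close>
  numbers the variables to match matrix indices.\<close>

definition quad_form :: "nat \<Rightarrow> (nat \<Rightarrow> var) \<Rightarrow> complex mat \<Rightarrow> cpoly" where
  "quad_form n v S =
     Const (1/2) * (\<Sum>a<n. \<Sum>b<n. Const (S $$ (a,b)) * (Var (v a) * Var (v b)))"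

text \<open>The degree 2k part of the exponential of the quadratic form. The exponential itself is
  not a polynomial and is represented by the sequence of these parts.\<close>

definition quad_exp :: "nat \<Rightarrow> (nat \<Rightarrow> var) \<Rightarrow> complex mat \<Rightarrow> nat \<Rightarrow> cpoly" where
  "quad_exp n v S k = Const (1 / fact k) * quad_form n v S ^ k"

lemma quad_exp_0 [simp]: "quad_exp n v S 0 = 1"
  by (simp add: quad_exp_def)

lemma pdiff_1 [simp]: "pdiff v 1 = 0"
  by (simp add: pdiff_single flip: single_one)

lemma quad_form_times_quad_exp:
  "quad_form n v S * quad_exp n v S k = Const (of_nat (Suc k)) * quad_exp n v S (Suc k)"
proof -
  have "(1 / fact k :: complex) = of_nat (Suc k) * (1 / fact (Suc k))"
    by (simp add: field_simps del: of_nat_Suc)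
  then have "Const (1 / fact k) = Const (of_nat (Suc k)) * Const (1 / fact (Suc k))"
    by (metis Const_mult)
  then show ?thesis
    unfolding quad_exp_def by (simp only: power_Suc mult_ac)
qed

context
  fixes v :: "nat \<Rightarrow> var" and n :: nat
  assumes inj: "inj v"
begin

text \<open>Each of the two variables in a term contributes once; symmetry of \<open>S\<close> makes
  the contributions equal, which cancels the factor 1/2. The factor \<open>f\<close> lets the rule
  be iterated over powers.\<close>

lemma pdiff_quad_form_mult:
  assumes S: "\<And>a b. a < n \<Longrightarrow> b < n \<Longrightarrow> S $$ (a,b) = S $$ (b,a)" and a: "a < n"
  shows "pdiff (v a) (quad_form n v S * f) =
    (\<Sum>b<n. Const (S $$ (a,b)) * Var (v b)) * f + quad_form n v S * pdiff (v a) f"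
proof -
  let ?L = "(\<Sum>b<n. Const (S $$ (a,b)) * Var (v b)) * f"
  have expand: "quad_form n v S * g = Const (1/2) * (\<Sum>c<n. \<Sum>b<n. Const (S $$ (c,b)) *
      (Var (v c) * (Var (v b) * g)))" for g
    by (simp add: quad_form_def sum_distrib_left sum_distrib_right mult_ac)
  have "pdiff (v a) (Var (v c) * (Var (v b) * f)) =
      (if a = c then Var (v b) * f else 0) + (if a = b then Var (v c) * f else 0)
      + Var (v c) * (Var (v b) * pdiff (v a) f)" for b c
    by (simp add: pdiff_Var_mult inj_eq[OF inj] distrib_left)
  then have "pdiff (v a) (quad_form n v S * f) = Const (1/2) * (\<Sum>c<n. \<Sum>b<n. Const (S $$ (c,b)) *
      ((if a = c then Var (v b) * f else 0) + (if a = b then Var (v c) * f else 0)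
      + Var (v c) * (Var (v b) * pdiff (v a) f)))"
    by (simp only: expand pdiff_Const_mult pdiff_sum)
  also have "\<dots> = Const (1/2) * ((\<Sum>c<n. \<Sum>b<n. Const (S $$ (c,b)) * (if a = c then Var (v b) * f else 0)) +
        (\<Sum>c<n. \<Sum>b<n. Const (S $$ (c,b)) * (if a = b then Var (v c) * f else 0)))
      + quad_form n v S * pdiff (v a) f"
    by (simp only: expand distrib_left sum.distrib)
  also have "(\<Sum>c<n. \<Sum>b<n. Const (S $$ (c,b)) * (if a = c then Var (v b) * f else 0)) = ?L"
    using a by (subst sum.swap) (simp add: if_distrib[of "\<lambda>x. _ * x"] sum_distrib_left
      mult_ac cong: if_cong)
  also have "(\<Sum>c<n. \<Sum>b<n. Const (S $$ (c,b)) * (if a = b then Var (v c) * f else 0)) = ?L"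
    using a S by (simp add: if_distrib[of "\<lambda>x. _ * x"] sum_distrib_left
      mult_ac cong: if_cong)
  also have "Const (1/2) * (?L + ?L) = ?L"
  proof -
    have "Const (1/2) * (?L + ?L) = (Const (1/2) + Const (1/2)) * ?L"
      by (simp only: distrib_left distrib_right)
    then show ?thesis by (simp flip: Const_add)
  qed
  finally show ?thesis .
qed

text \<open>The chain rule for the exponential, read in a single degree; this is why the index drops
  by one.\<close>

lemma pdiff_quad_exp_Suc:
  assumes S: "\<And>a b. a < n \<Longrightarrow> b < n \<Longrightarrow> S $$ (a,b) = S $$ (b,a)" and a: "a < n"
  shows "pdiff (v a) (quad_exp n v S (Suc k)) =
    (\<Sum>b<n. Const (S $$ (a,b)) * (Var (v b) * quad_exp n v S k))"
proof -
  define L where "L = (\<Sum>b<n. Const (S $$ (a,b)) * Var (v b))"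
  have "pdiff (v a) (quad_form n v S ^ Suc k) = Const (of_nat (Suc k)) * (L * quad_form n v S ^ k)"
  proof (induction k)
    case 0
    show ?case using pdiff_quad_form_mult[OF S a, of 1] by (simp add: L_def)
  next
    case (Suc k)
    have "pdiff (v a) (quad_form n v S ^ Suc (Suc k)) = L * quad_form n v S ^ Suc k +
        quad_form n v S * (Const (of_nat (Suc k)) * (L * quad_form n v S ^ k))"
      by (simp only: power_Suc[of _ "Suc k"] pdiff_quad_form_mult[OF S a] L_def[symmetric] Suc)
    then show ?case
      by (simp only: of_nat_Suc[of "Suc k"] Const_add Const_1 power_Suc distrib_left distrib_right mult_1_left mult_ac)
  qed
  then have "pdiff (v a) (quad_exp n v S (Suc k)) =
      (Const (1 / fact (Suc k)) * Const (of_nat (Suc k))) * (L * quad_form n v S ^ k)"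
    by (simp only: quad_exp_def pdiff_Const_mult mult.assoc)
  also have "Const (1 / fact (Suc k)) * Const (of_nat (Suc k)) = Const (1 / fact k)"
    unfolding Const_mult[symmetric] by (simp add: field_simps del: of_nat_Suc)
  finally have "pdiff (v a) (quad_exp n v S (Suc k)) = L * quad_exp n v S k"
    by (simp only: quad_exp_def mult.left_commute)
  then show ?thesis
    by (simp add: L_def sum_distrib_left mult_ac)
qed

text \<open>Moving \<open>u_b\<close> across the pairing gives \<open>M = N R\<close>; moving
  \<open>u_c\<close> gives \<open>N = G 1 + s M S\<close>, where \<open>G 1\<close> comes from the
  commutator and s is the formal variable. Hence \<open>M = G R + s M S R\<close>, as
  \<open>fps_square_det_eq_1\<close> requires.\<close>

lemma quad_exp_generating_function:
  assumes S: "S \<in> carrier_mat n n" and T: "T \<in> carrier_mat n n"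
    and symS: "\<And>a b. a < n \<Longrightarrow> b < n \<Longrightarrow> S $$ (a,b) = S $$ (b,a)"
    and symT: "\<And>a b. a < n \<Longrightarrow> b < n \<Longrightarrow> T $$ (a,b) = T $$ (b,a)"
  shows "Abs_fps (\<lambda>k. fock_inner (quad_exp n v S k) (quad_exp n v T k)) ^ 2 *
    det (1\<^sub>m n - fps_X \<cdot>\<^sub>m map_mat fps_const (S * map_mat cnj T)) = 1"
proof -
  define R where "R = map_mat cnj T"
  have R: "R \<in> carrier_mat n n" using T by (simp add: R_def)
  define g where "g k = fock_inner (quad_exp n v S k) (quad_exp n v T k)" for k
  \<comment> \<open>The second index is k + 1 because both sides of the pairing must have degree 2k
    + 2; in \<open>N\<close> both have degree 2k + 1.\<close>
  define M where "M a b k = fock_inner (Var (v a) * (Var (v b) * quad_exp n v S k))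
    (quad_exp n v T (Suc k))" for a b k
  define N where "N a c k = fock_inner (Var (v a) * quad_exp n v S k)
    (Var (v c) * quad_exp n v T k)" for a c k
  have M_N: "M a b k = (\<Sum>c<n. N a c k * R $$ (c,b))" if "a < n" "b < n" for a b k
  proof -
    have "M a b k = fock_inner (Var (v a) * quad_exp n v S k)
        (pdiff (v b) (quad_exp n v T (Suc k)))"
      unfolding M_def by (subst fock_inner_Var_left[symmetric]) (simp add: mult_ac)
    also have "\<dots> = (\<Sum>c<n. cnj (T $$ (b,c)) * N a c k)"
      using that
      by (simp add: pdiff_quad_exp_Suc[OF symT] fock_inner_sum_right fock_inner_Const_right N_def)
    also have "\<dots> = (\<Sum>c<n. N a c k * R $$ (c,b))"
      using that T by (intro sum.cong refl) (simp add: R_def symT[of b])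
    finally show ?thesis .
  qed
  have N_rec: "N a c k = (if a = c then g k else 0) +
      fock_inner (Var (v a) * pdiff (v c) (quad_exp n v S k)) (quad_exp n v T k)" for a c k
    by (simp add: N_def g_def fock_inner_Var_right pdiff_Var_mult fock_inner_add_left
      inj_eq[OF inj] eq_commute[of a])
  \<comment> \<open>For k = 0 the differentiated factor is 1, so only the delta remains:
    \<open>s M S\<close> has no constant term.\<close>
  have N_0: "N a c 0 = (if a = c then g 0 else 0)" for a c
    unfolding N_rec by simp
  have N_Suc: "N a c (Suc k) = (if a = c then g (Suc k) else 0) + (\<Sum>d<n. M a d k * S $$ (d,c))"
    if "a < n" "c < n" for a c k
  proof -
    have "fock_inner (Var (v a) * pdiff (v c) (quad_exp n v S (Suc k))) (quad_exp n v T (Suc k)) =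
        fock_inner (\<Sum>d<n. Const (S $$ (c,d)) * (Var (v a) * (Var (v d) * quad_exp n v S k)))
          (quad_exp n v T (Suc k))"
      using that by (simp add: pdiff_quad_exp_Suc[OF symS] sum_distrib_left mult_ac)
    also have "\<dots> = (\<Sum>d<n. M a d k * S $$ (d,c))"
      unfolding fock_inner_sum_left fock_inner_Const_left M_def
      using that by (intro sum.cong refl) (simp add: symS[of c])
    finally show ?thesis unfolding N_rec by simp
  qed
  have M_0: "M a b 0 = g 0 * R $$ (a,b)" if "a < n" "b < n" for a b
    using that by (simp add: M_N N_0 if_distrib[of "\<lambda>x. x * _"] cong: if_cong)
  have M_Suc: "M a b (Suc k) = g (Suc k) * R $$ (a,b) + (\<Sum>d<n. M a d k * (S * R) $$ (d,b))"
    if "a < n" "b < n" for a b k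
  proof -
    have "M a b (Suc k) = (\<Sum>c<n. (if a = c then g (Suc k) else 0) * R $$ (c,b)) +
        (\<Sum>c<n. \<Sum>d<n. M a d k * S $$ (d,c) * R $$ (c,b))"
      using that by (simp add: M_N[of a b "Suc k"] N_Suc distrib_right sum.distrib sum_distrib_right)
    also have "(\<Sum>c<n. (if a = c then g (Suc k) else 0) * R $$ (c,b)) = g (Suc k) * R $$ (a,b)"
      using that by (simp add: if_distrib[of "\<lambda>x. x * _"] cong: if_cong)
    also have "(\<Sum>c<n. \<Sum>d<n. M a d k * S $$ (d,c) * R $$ (c,b)) =
        (\<Sum>d<n. M a d k * (S * R) $$ (d,b))"
      using that S R by (subst sum.swap)
        (simp add: scalar_prod_def sum_distrib_left lessThan_atLeast0 mult_ac)
    finally show ?thesis .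
  qed
  have g_Suc: "2 * (of_nat (Suc k) * g (Suc k)) = (\<Sum>a<n. \<Sum>b<n. S $$ (a,b) * M b a k)" for k
  proof -
    have "of_nat (Suc k) * g (Suc k) =
        fock_inner (quad_form n v S * quad_exp n v S k) (quad_exp n v T (Suc k))"
      by (simp only: quad_form_times_quad_exp fock_inner_Const_left g_def)
    \<comment> \<open>The variables are written in the order b, a so that the sum becomes the trace
      of \<open>S M\<close>.\<close>
    also have "quad_form n v S * quad_exp n v S k = Const (1/2) *
        (\<Sum>a<n. \<Sum>b<n. Const (S $$ (a,b)) * (Var (v b) * (Var (v a) * quad_exp n v S k)))"
      by (simp add: quad_form_def sum_distrib_left sum_distrib_right mult_ac)
    finally have "of_nat (Suc k) * g (Suc k) = 1/2 * (\<Sum>a<n. \<Sum>b<n. S $$ (a,b) * M b a k)"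
      by (simp only: fock_inner_Const_left fock_inner_sum_left M_def)
    then show ?thesis by (simp del: of_nat_Suc add: mult.commute)
  qed
  define Mf where "Mf = mat n n (\<lambda>(a,b). Abs_fps (M a b))"
  define G where "G = Abs_fps g"
  have "G ^ 2 * det (1\<^sub>m n - fps_X \<cdot>\<^sub>m map_mat fps_const (S * R)) = 1"
  proof (rule fps_square_det_eq_1[OF S R, of Mf])
    show "Mf \<in> carrier_mat n n" by (simp add: Mf_def)
    show "fps_nth G 0 = 1"
      using fock_inner_single[of 0 1 0 1] by (simp add: G_def g_def mono_fact_def)
    show "2 * fps_deriv G = (\<Sum>a<n. (map_mat fps_const S * Mf) $$ (a,a))"
    proof (rule fps_ext)
      fix k
      have "fps_nth (2 * fps_deriv G) k = 2 * (of_nat (Suc k) * g (Suc k))"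
        by (simp only: mult_2 fps_add_nth fps_deriv_nth G_def fps_nth_Abs_fps Suc_eq_plus1)
      also have "\<dots> = fps_nth (\<Sum>a<n. (map_mat fps_const S * Mf) $$ (a,a)) k"
        unfolding g_Suc fps_sum_nth using S
        by (intro sum.cong refl)
          (simp add: Mf_def scalar_prod_def fps_sum_nth lessThan_atLeast0)
      finally show "fps_nth (2 * fps_deriv G) k =
          fps_nth (\<Sum>a<n. (map_mat fps_const S * Mf) $$ (a,a)) k" .
    qed
    show "Mf * (1\<^sub>m n - fps_X \<cdot>\<^sub>m map_mat fps_const (S * R)) = G \<cdot>\<^sub>m map_mat fps_const R"
    proof (rule eq_matI)
      fix a b
      assume "a < dim_row (G \<cdot>\<^sub>m map_mat fps_const R)" "b < dim_col (G \<cdot>\<^sub>m map_mat fps_const R)"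
      then have ab: "a < n" "b < n" using R by auto
      define K where "K = S * R"
      have K: "K \<in> carrier_mat n n" using S R by (simp add: K_def)
      have "(Mf * (1\<^sub>m n - fps_X \<cdot>\<^sub>m map_mat fps_const K)) $$ (a,b) =
          (\<Sum>d<n. Abs_fps (M a d) * ((if d = b then 1 else 0) - fps_X * fps_const (K $$ (d,b))))"
        using ab K by (simp add: Mf_def scalar_prod_def lessThan_atLeast0)
      also have "\<dots> = (\<Sum>d<n. if d = b then Abs_fps (M a d) else 0) -
          (\<Sum>d<n. fps_X * (Abs_fps (M a d) * fps_const (K $$ (d,b))))"
        unfolding sum_subtractf[symmetric]
        by (rule sum.cong) (simp_all add: right_diff_distrib mult.left_commute)
      also have "\<dots> = Abs_fps (M a b) -
          fps_X * (\<Sum>d<n. Abs_fps (M a d) * fps_const (K $$ (d,b)))"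
        using ab by (simp add: sum_distrib_left)
      also have "\<dots> = G * fps_const (R $$ (a,b))"
      proof (rule fps_ext)
        fix k
        \<comment> \<open>Multiplication by \<open>fps_X\<close> shifts coefficients: the
          coefficient at 0 is \<open>M_0\<close>, all others are \<open>M_Suc\<close>.\<close>
        show "fps_nth (Abs_fps (M a b) -
          fps_X * (\<Sum>d<n. Abs_fps (M a d) * fps_const (K $$ (d,b)))) k =
          fps_nth (G * fps_const (R $$ (a,b))) k"
          by (cases k) (simp_all only: fps_sub_nth fps_X_mult_nth fps_sum_nth
            fps_mult_right_const_nth fps_nth_Abs_fps M_0[OF ab] M_Suc[OF ab] G_def K_def, simp_all)
      qed
      finally show "(Mf * (1\<^sub>m n - fps_X \<cdot>\<^sub>m map_mat fps_const (S * R))) $$ (a,b) =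
          (G \<cdot>\<^sub>m map_mat fps_const R) $$ (a,b)"
        unfolding K_def using ab R by simp
    qed (use S R in \<open>simp_all add: Mf_def\<close>)
  qed
  then show ?thesis by (simp add: G_def g_def[abs_def] R_def)
qed

end

subsection \<open>Substitution\<close>

abbreviation monom_subst :: "(var \<Rightarrow> cpoly) \<Rightarrow> mono \<Rightarrow> cpoly" where
  "monom_subst \<sigma> m \<equiv> \<Prod>v\<in>Poly_Mapping.keys m. \<sigma> v ^ Poly_Mapping.lookup m v"

lemma monom_subst_superset:
  assumes "finite K" "Poly_Mapping.keys m \<subseteq> K"
  shows "monom_subst \<sigma> m = (\<Prod>v\<in>K. \<sigma> v ^ Poly_Mapping.lookup m v)"
  using assms by (intro prod.mono_neutral_left) (auto simp: in_keys_iff)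

lemma monom_subst_add: "monom_subst \<sigma> (m + m') = monom_subst \<sigma> m * monom_subst \<sigma> m'"
proof -
  let ?K = "Poly_Mapping.keys m \<union> Poly_Mapping.keys m'"
  have "monom_subst \<sigma> (m + m') = (\<Prod>v\<in>?K. \<sigma> v ^ Poly_Mapping.lookup (m + m') v)"
    by (intro monom_subst_superset) (auto simp: keys_add)
  also have "\<dots> = (\<Prod>v\<in>?K. \<sigma> v ^ Poly_Mapping.lookup m v) * (\<Prod>v\<in>?K. \<sigma> v ^ Poly_Mapping.lookup m' v)"
    by (simp add: lookup_add power_add prod.distrib)
  also have "\<dots> = monom_subst \<sigma> m * monom_subst \<sigma> m'"
    by (subst (1 2) monom_subst_superset[of ?K]) auto
  finally show ?thesis .
qed

lemma subst_add: "subst \<sigma> (f + g) = subst \<sigma> f + subst \<sigma> g"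
  unfolding subst_def
  by (rule setsum_keys_plus_distrib) (simp_all add: Const_add algebra_simps)

lemma subst_single: "subst \<sigma> (Poly_Mapping.single m c) = Const c * monom_subst \<sigma> m"
  by (simp add: subst_def)

text \<open>Both sides are biadditive, so two single terms suffice, where the law of exponents
  \<open>monom_subst_add\<close> applies.\<close>

lemma subst_mult: "subst \<sigma> (f * g) = subst \<sigma> f * subst \<sigma> g"
proof (induction f rule: poly_mapping_single_induct)
  case (single m c)
  show ?case
    by (induction g rule: poly_mapping_single_induct)
       (simp_all add: mult_single subst_single monom_subst_add Const_mult subst_add
          distrib_left mult.assoc mult.left_commute)
qed (simp add: subst_add distrib_right)

lemma subst_Const: "subst \<sigma> (Const c) = Const c"
  by (simp add: Const_def subst_single mult_single flip: single_one)

lemma subst_Var: "subst \<sigma> (Var v) = \<sigma> v"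
  by (simp add: Var_def subst_single)

lemma subst_diff: "subst \<sigma> (f - g) = subst \<sigma> f - subst \<sigma> g"
  by (metis add_diff_cancel_right' diff_add_cancel subst_add)

lemma subst_1: "subst \<sigma> 1 = 1"
  using subst_Const[of \<sigma> 1] by simp

lemma subst_power: "subst \<sigma> (f ^ k) = subst \<sigma> f ^ k"
  by (induction k) (simp_all add: subst_1 subst_mult)

lemma subst_prod: "subst \<sigma> (prod f I) = (\<Prod>i\<in>I. subst \<sigma> (f i))"
  by (induction I rule: infinite_finite_induct) (simp_all add: subst_1 subst_mult)

subsection \<open>Homogeneous polynomials\<close>

text \<open>The weight \<open>w\<close> is a parameter: it becomes the total degree or the degree in
  one \<open>u_r\<close>. The zero polynomial is homogeneous of every degree.\<close>

definition homogeneous :: "(mono \<Rightarrow> nat) \<Rightarrow> nat \<Rightarrow> cpoly \<Rightarrow> bool" where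
  "homogeneous w d f \<longleftrightarrow> (\<forall>m\<in>Poly_Mapping.keys f. w m = d)"

lemma homogeneous_add:
  "homogeneous w d f \<Longrightarrow> homogeneous w d g \<Longrightarrow> homogeneous w d (f + g)"
  unfolding homogeneous_def using keys_add[of f g] by blast

lemma homogeneous_diff:
  "homogeneous w d f \<Longrightarrow> homogeneous w d g \<Longrightarrow> homogeneous w d (f - g)"
  unfolding homogeneous_def by (auto simp: in_keys_iff lookup_minus)

lemma homogeneous_sum:
  "(\<And>i. i \<in> I \<Longrightarrow> homogeneous w d (f i)) \<Longrightarrow> homogeneous w d (sum f I)"
  by (induction I rule: infinite_finite_induct)
     (auto simp: homogeneous_add, auto simp: homogeneous_def)

lemma homogeneous_Var: "homogeneous w (w (Poly_Mapping.single v 1)) (Var v)"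
  by (auto simp: homogeneous_def Var_def)

lemma fock_inner_homogeneous_eq_0:
  assumes "homogeneous w d f" "homogeneous w e g" "d \<noteq> e"
  shows "fock_inner f g = 0"
  unfolding fock_inner_def
proof (rule sum.neutral, rule ballI)
  fix m
  have "m \<notin> Poly_Mapping.keys f \<or> m \<notin> Poly_Mapping.keys g"
    using assms by (auto simp: homogeneous_def)
  then show "Poly_Mapping.lookup f m * cnj (Poly_Mapping.lookup g m) * of_nat (mono_fact m) = 0"
    by (auto simp: in_keys_iff)
qed

context
  fixes w :: "mono \<Rightarrow> nat"
  assumes w_0: "w 0 = 0" and w_add: "\<And>m m'. w (m + m') = w m + w m'"
begin

lemma homogeneous_Const: "homogeneous w 0 (Const c)"
  by (simp add: homogeneous_def Const_def w_0)

lemma homogeneous_mult: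
  "homogeneous w d f \<Longrightarrow> homogeneous w e g \<Longrightarrow> homogeneous w (d + e) (f * g)"
  unfolding homogeneous_def using keys_mult[of f g] w_add by fastforce

lemma homogeneous_power: "homogeneous w d f \<Longrightarrow> homogeneous w (k * d) (f ^ k)"
proof (induction k)
  case 0
  show ?case using homogeneous_Const[of 1] by simp
qed (simp add: homogeneous_mult)

lemma homogeneous_prod:
  "(\<And>i. i \<in> I \<Longrightarrow> homogeneous w (d i) (f i)) \<Longrightarrow> homogeneous w (sum d I) (prod f I)"
proof (induction I rule: infinite_finite_induct)
  case (infinite I)
  then show ?case using homogeneous_Const[of 1] by simp
next
  case empty
  show ?case using homogeneous_Const[of 1] by simp
qed (simp add: homogeneous_mult)

end

subsection \<open>The \<open>\<ell>\<^sup>1\<close> norm of the coefficients\<close>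

definition coeff_norm :: "cpoly \<Rightarrow> real" where
  "coeff_norm f = (\<Sum>m\<in>Poly_Mapping.keys f. cmod (Poly_Mapping.lookup f m))"

lemma coeff_norm_superset:
  assumes "finite K" "Poly_Mapping.keys f \<subseteq> K"
  shows "coeff_norm f = (\<Sum>m\<in>K. cmod (Poly_Mapping.lookup f m))"
  unfolding coeff_norm_def using assms
  by (intro sum.mono_neutral_left) (auto simp: in_keys_iff)

lemma coeff_norm_nonneg [simp]: "0 \<le> coeff_norm f"
  by (simp add: coeff_norm_def sum_nonneg)

lemma coeff_norm_0 [simp]: "coeff_norm 0 = 0"
  by (simp add: coeff_norm_def)

lemma coeff_norm_single [simp]: "coeff_norm (Poly_Mapping.single m c) = cmod c"
  by (simp add: coeff_norm_def)

lemma coeff_norm_1 [simp]: "coeff_norm 1 = 1"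
  by (simp flip: single_one)

lemma coeff_norm_add: "coeff_norm (f + g) \<le> coeff_norm f + coeff_norm g"
proof -
  let ?K = "Poly_Mapping.keys f \<union> Poly_Mapping.keys g"
  have "coeff_norm (f + g) = (\<Sum>m\<in>?K. cmod (Poly_Mapping.lookup (f + g) m))"
    by (rule coeff_norm_superset) (auto simp: keys_add)
  also have "\<dots> \<le> (\<Sum>m\<in>?K. cmod (Poly_Mapping.lookup f m) + cmod (Poly_Mapping.lookup g m))"
    by (intro sum_mono) (simp add: lookup_add norm_triangle_ineq)
  also have "\<dots> = coeff_norm f + coeff_norm g"
    by (simp add: sum.distrib coeff_norm_superset[of ?K])
  finally show ?thesis .
qed

lemma coeff_norm_sum: "coeff_norm (sum f I) \<le> (\<Sum>i\<in>I. coeff_norm (f i))"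
proof (induction I rule: infinite_finite_induct)
  case (insert i I)
  then show ?case using coeff_norm_add[of "f i" "sum f I"] by simp
qed simp_all

text \<open>The product expands into terms \<open>single (m + m')\<close>; coinciding monomials can
  only lower the norm. The Fock norm is not submultiplicative, so powers and products are estimated
  in this norm.\<close>

lemma coeff_norm_mult: "coeff_norm (f * g) \<le> coeff_norm f * coeff_norm g"
proof -
  have "f * g = (\<Sum>m\<in>Poly_Mapping.keys f. \<Sum>m'\<in>Poly_Mapping.keys g.
      Poly_Mapping.single (m + m') (Poly_Mapping.lookup f m * Poly_Mapping.lookup g m'))"
    by (subst (1) poly_mapping_sum_single[of f], subst (1) poly_mapping_sum_single[of g])
       (simp add: sum_product mult_single)
  also have "coeff_norm \<dots> \<le> (\<Sum>m\<in>Poly_Mapping.keys f. \<Sum>m'\<in>Poly_Mapping.keys g.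
      cmod (Poly_Mapping.lookup f m * Poly_Mapping.lookup g m'))"
    by (rule order_trans[OF coeff_norm_sum] sum_mono)+ simp
  also have "\<dots> = coeff_norm f * coeff_norm g"
    by (simp add: coeff_norm_def sum_product norm_mult)
  finally show ?thesis .
qed

lemma coeff_norm_power: "coeff_norm (f ^ k) \<le> coeff_norm f ^ k"
proof (induction k)
  case (Suc k)
  have "coeff_norm (f ^ Suc k) \<le> coeff_norm f * coeff_norm (f ^ k)"
    using coeff_norm_mult by simp
  also have "\<dots> \<le> coeff_norm f ^ Suc k"
    using Suc by (simp add: mult_left_mono)
  finally show ?case .
qed simp

lemma coeff_norm_prod: "coeff_norm (prod f I) \<le> (\<Prod>i\<in>I. coeff_norm (f i))"
proof (induction I rule: infinite_finite_induct)
  case (insert i I)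
  have "coeff_norm (prod f (insert i I)) \<le> coeff_norm (f i) * coeff_norm (prod f I)"
    using insert coeff_norm_mult by simp
  also have "\<dots> \<le> (\<Prod>i\<in>insert i I. coeff_norm (f i))"
    using insert by (simp add: mult_left_mono)
  finally show ?case .
qed simp_all

section \<open>Total degree and a bound for the inner product\<close>

definition total_degree :: "mono \<Rightarrow> nat" where
  "total_degree m = (\<Sum>v\<in>Poly_Mapping.keys m. Poly_Mapping.lookup m v)"

lemma total_degree_0: "total_degree 0 = 0"
  by (simp add: total_degree_def)

lemma total_degree_add: "total_degree (m + m') = total_degree m + total_degree m'"
  unfolding total_degree_def by (rule setsum_keys_plus_distrib) simp_all

text \<open>The quotient is a multinomial coefficient, hence a positive integer.\<close>

lemma prod_fact_le_fact_sum: "(\<Prod>i\<in>I. fact (k i)) \<le> (fact (\<Sum>i\<in>I. k i) :: nat)"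
proof (induction I rule: infinite_finite_induct)
  case (insert i I)
  have "(\<Prod>i\<in>insert i I. fact (k i)) \<le> fact (k i) * (fact (\<Sum>i\<in>I. k i) :: nat)"
    using insert by simp
  also have "\<dots> \<le> fact (k i + (\<Sum>i\<in>I. k i))"
    by (rule dvd_imp_le[OF fact_fact_dvd_fact]) simp
  finally show ?case using insert by simp
qed simp_all

text \<open>A monomial of degree d has weight at most d!, and every coefficient of \<open>g\<close>
  is at most \<open>coeff_norm g\<close>.\<close>

lemma norm_fock_inner_le:
  assumes "homogeneous total_degree d f"
  shows "cmod (fock_inner f g) \<le> fact d * coeff_norm f * coeff_norm g"
proof -
  have g: "cmod (Poly_Mapping.lookup g m) \<le> coeff_norm g" for m
  proof -
    have "cmod (Poly_Mapping.lookup g m) \<le>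
        (\<Sum>m\<in>insert m (Poly_Mapping.keys g). cmod (Poly_Mapping.lookup g m))"
      by (rule member_le_sum) auto
    also have "\<dots> = coeff_norm g"
      by (rule coeff_norm_superset[symmetric]) auto
    finally show ?thesis .
  qed
  have "cmod (fock_inner f g) \<le> (\<Sum>m\<in>Poly_Mapping.keys f.
      cmod (Poly_Mapping.lookup f m) * cmod (Poly_Mapping.lookup g m) * real (mono_fact m))"
    unfolding fock_inner_left
    by (rule order_trans[OF norm_sum]) (simp add: norm_mult)
  also have "\<dots> \<le> (\<Sum>m\<in>Poly_Mapping.keys f. cmod (Poly_Mapping.lookup f m) * coeff_norm g * fact d)"
  proof (intro sum_mono mult_mono)
    fix m assume m: "m \<in> Poly_Mapping.keys f"
    have "mono_fact m \<le> fact (total_degree m)"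
      unfolding mono_fact_def total_degree_def by (rule prod_fact_le_fact_sum)
    also have "total_degree m = d" using assms m by (simp add: homogeneous_def)
    finally show "real (mono_fact m) \<le> fact d"
      by (metis of_nat_fact of_nat_le_iff)
  qed (auto simp: g)
  also have "\<dots> = fact d * coeff_norm f * coeff_norm g"
    by (simp add: coeff_norm_def sum_distrib_left sum_distrib_right mult_ac)
  finally show ?thesis .
qed

subsection \<open>The multinomial theorem\<close>

text \<open>Vanishing outside \<open>P\<close> makes such a function determined by its values on
  \<open>P\<close>, so the set is finite for finite \<open>P\<close>.\<close>

definition compositions :: "'p set \<Rightarrow> nat \<Rightarrow> ('p \<Rightarrow> nat) set" where
  "compositions P n = {a. (\<forall>p. p \<notin> P \<longrightarrow> a p = 0) \<and> sum a P = n}"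

lemma finite_compositions:
  assumes "finite P"
  shows "finite (compositions P n)"
proof (rule finite_subset)
  show "compositions P n \<subseteq> {a. \<forall>p. (p \<in> P \<longrightarrow> a p \<in> {..n}) \<and> (p \<notin> P \<longrightarrow> a p = 0)}"
    using assms by (auto simp: compositions_def intro: member_le_sum)
  show "finite {a. \<forall>p. (p \<in> P \<longrightarrow> a p \<in> {..n}) \<and> (p \<notin> P \<longrightarrow> a p = (0::nat))}"
    using assms by (intro finite_set_of_finite_funs) auto
qed

text \<open>\<open>c k\<close> plays the role of 1/k! in a ring without division, so the reals and
  \<open>cpoly\<close> are covered at once. The induction splits off one summand by the binomial
  theorem.\<close>

lemma multinomial_divided_powers:
  fixes x :: "'p \<Rightarrow> 'a::comm_ring_1" and c :: "nat \<Rightarrow> 'a"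
  assumes c: "\<And>k. of_nat (fact k) * c k = 1" and "finite P"
  shows "c n * sum x P ^ n = (\<Sum>a\<in>compositions P n. \<Prod>p\<in>P. c (a p) * x p ^ a p)"
  using assms(2)
proof (induction P arbitrary: n rule: finite_induct)
  case empty
  have "compositions {} n = (if n = 0 then {\<lambda>_::'p. 0} else {})"
    by (auto simp: compositions_def)
  then show ?case using c[of 0] by (auto simp: power_0_left)
next
  case (insert q P)
  \<comment> \<open>Inserting k! c(k) = 1 and (n-k)! c(n-k) = 1 completes the binomial coefficient
    to n!, which cancels \<open>c n\<close>.\<close>
  have choose: "c n * of_nat (n choose k) = c k * c (n - k)" if "k \<le> n" for k
  proof -
    have "c n * of_nat (n choose k) =
        c n * of_nat (n choose k) * (of_nat (fact k) * c k) * (of_nat (fact (n - k)) * c (n - k))"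
      by (simp add: c del: of_nat_fact)
    also have "\<dots> = (of_nat (fact k * fact (n - k) * (n choose k)) * c n) * (c k * c (n - k))"
      by (simp add: mult_ac del: of_nat_fact)
    also have "\<dots> = c k * c (n - k)"
      using that by (simp add: binomial_fact_lemma c del: of_nat_fact of_nat_mult)
    finally show ?thesis .
  qed
  have "c n * sum x (insert q P) ^ n = c n * (x q + sum x P) ^ n"
    using insert by simp
  also have "\<dots> = (\<Sum>k\<le>n. c n * of_nat (n choose k) * x q ^ k * sum x P ^ (n - k))"
    by (simp add: binomial_ring sum_distrib_left mult.assoc)
  also have "\<dots> = (\<Sum>k\<le>n. (c k * x q ^ k) * (c (n - k) * sum x P ^ (n - k)))"
    by (intro sum.cong refl) (simp add: choose mult_ac)
  also have "\<dots> = (\<Sum>k\<le>n. \<Sum>b\<in>compositions P (n - k).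
      (c k * x q ^ k) * (\<Prod>p\<in>P. c (b p) * x p ^ b p))"
    by (simp add: insert.IH sum_distrib_left)
  also have "\<dots> = (\<Sum>(k,b)\<in>Sigma {..n} (\<lambda>k. compositions P (n - k)).
      (c k * x q ^ k) * (\<Prod>p\<in>P. c (b p) * x p ^ b p))"
    using insert by (intro sum.Sigma) (auto simp: finite_compositions)
  also have "\<dots> = (\<Sum>a\<in>compositions (insert q P) n. \<Prod>p\<in>insert q P. c (a p) * x p ^ a p)"
  \<comment> \<open>A composition of \<open>insert q P\<close> corresponds to its value k at
    \<open>q\<close> together with the composition of n - k on \<open>P\<close> obtained by
    resetting \<open>q\<close> to 0.\<close>
  proof (rule sum.reindex_bij_witness[where i = "\<lambda>a. (a q, a(q := 0))" and j = "\<lambda>(k,b). b(q := k)"])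
    have upd: "(\<Sum>p\<in>P. if p = q then k else b p) = sum b P"
      "(\<Prod>p\<in>P. c (if p = q then k else b p)) = (\<Prod>p\<in>P. c (b p))"
      "(\<Prod>p\<in>P. x p ^ (if p = q then k else b p)) = (\<Prod>p\<in>P. x p ^ b p)" for k b
      by (rule sum.cong prod.cong; use insert.hyps in auto)+
    fix y assume "y \<in> Sigma {..n} (\<lambda>k. compositions P (n - k))"
    then obtain k b where y: "y = (k,b)" "k \<le> n" "b \<in> compositions P (n - k)" by auto
    then have bq: "b q = 0" using insert by (auto simp: compositions_def)
    show "((case y of (k,b) \<Rightarrow> b(q := k)) q, (case y of (k,b) \<Rightarrow> b(q := k))(q := 0)) = y"
      using y bq by (auto simp: fun_eq_iff)
    show "(case y of (k,b) \<Rightarrow> b(q := k)) \<in> compositions (insert q P) n"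
      using y insert by (auto simp: compositions_def fun_upd_def upd)
    show "(\<Prod>p\<in>insert q P. c ((case y of (k,b) \<Rightarrow> b(q := k)) p) *
        x p ^ (case y of (k,b) \<Rightarrow> b(q := k)) p) =
      (case y of (k,b) \<Rightarrow> (c k * x q ^ k) * (\<Prod>p\<in>P. c (b p) * x p ^ b p))"
      using y insert.hyps by (auto simp: fun_upd_def upd prod.distrib mult_ac)
  next
    fix a assume a: "a \<in> compositions (insert q P) n"
    show "(case (a q, a(q := 0)) of (k,b) \<Rightarrow> b(q := k)) = a" by simp
    have "(\<Sum>p\<in>P. if p = q then 0 else a p) = sum a P"
      using insert by (intro sum.cong) auto
    then show "(a q, a(q := 0)) \<in> Sigma {..n} (\<lambda>k. compositions P (n - k))"
      using a insert by (auto simp: compositions_def fun_upd_def)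
  qed
  finally show ?case .
qed

subsection \<open>Sums over pairs\<close>

abbreviation (input) pairs :: "nat \<Rightarrow> (nat \<times> nat) set" where
  "pairs l \<equiv> {(i,j). i < j \<and> j < l}"

lemma finite_pairs: "finite (pairs l)"
  by (rule finite_subset[of _ "{..<l} \<times> {..<l}"]) auto

text \<open>The part below the diagonal is the part above it with indices swapped. The factor 1/2 in
  a quadratic form removes this doubling.\<close>

lemma sum_pairs:
  fixes h :: "nat \<Rightarrow> nat \<Rightarrow> 'a::comm_monoid_add"
  shows "(\<Sum>i<l. \<Sum>j<l. if i < j then h i j else if j < i then h j i else 0) =
    (\<Sum>(i,j)\<in>pairs l. h i j) + (\<Sum>(i,j)\<in>pairs l. h i j)"
proof -
  have half: "(\<Sum>i<l. \<Sum>j<l. if i < j then h i j else 0) = (\<Sum>(i,j)\<in>pairs l. h i j)"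
  proof -
    have "(\<Sum>i<l. \<Sum>j<l. if i < j then h i j else 0) =
        (\<Sum>(i,j)\<in>{..<l} \<times> {..<l}. if i < j then h i j else 0)"
      by (rule sum.cartesian_product)
    also have "\<dots> = (\<Sum>(i,j)\<in>pairs l. if i < j then h i j else 0)"
      by (rule sum.mono_neutral_right) (auto split: if_splits)
    also have "\<dots> = (\<Sum>(i,j)\<in>pairs l. h i j)"
      by (rule sum.cong) auto
    finally show ?thesis .
  qed
  have "(\<Sum>i<l. \<Sum>j<l. if i < j then h i j else if j < i then h j i else 0) =
      (\<Sum>i<l. \<Sum>j<l. (if i < j then h i j else 0) + (if j < i then h j i else 0))"
    by (intro sum.cong refl) auto
  also have "\<dots> = (\<Sum>i<l. \<Sum>j<l. if i < j then h i j else 0) +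
      (\<Sum>i<l. \<Sum>j<l. if j < i then h j i else 0)"
    by (simp add: sum.distrib)
  also have "(\<Sum>i<l. \<Sum>j<l. if j < i then h j i else 0) = (\<Sum>i<l. \<Sum>j<l. if i < j then h i j else 0)"
    by (rule sum.swap)
  finally show ?thesis by (simp only: half)
qed

lemma sum_pairs_symmetric:
  fixes h :: "nat \<Rightarrow> nat \<Rightarrow> nat"
  assumes "\<And>i j. h i j = h j i" "\<And>i. h i i = 0"
  shows "(\<Sum>i<l. \<Sum>j<l. h i j) = 2 * (\<Sum>(i,j)\<in>pairs l. h i j)"
proof -
  have "(\<Sum>i<l. \<Sum>j<l. h i j) =
      (\<Sum>i<l. \<Sum>j<l. if i < j then h i j else if j < i then h j i else 0)"
    using assms by (intro sum.cong refl) (metis linorder_neqE_nat)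
  then show ?thesis by (simp add: sum_pairs)
qed

lemma sum_lessThan_double:
  fixes f :: "nat \<Rightarrow> 'a::comm_monoid_add"
  shows "(\<Sum>c<2*l. f c) = (\<Sum>i<l. f (2*i) + f (2*i+1))"
  by (induction l) (simp_all add: add_ac)

subsection \<open>The quadratic form of \<open>T\<close>\<close>

text \<open>Flat indices run through (0,0), (0,1), (1,0), (1,1) and so on, matching the 2 by 2 block
  layout of \<open>Tmat\<close> and \<open>Umat\<close>.\<close>

definition coord :: "nat \<Rightarrow> var" where
  "coord a = (a div 2, a mod 2)"

lemma inj_coord: "inj coord"
  unfolding coord_def by (rule injI) (metis div_mult_mod_eq prod.inject)

lemma coord_double [simp]: "coord (2*i) = (i,0)" "coord (2*i+1) = (i,1)" "coord (Suc (2*i)) = (i,1)"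
  by (simp_all add: coord_def)

lemma Tmat_carrier [simp]: "Tmat l t \<in> carrier_mat (2*l) (2*l)"
  and Umat_carrier [simp]: "Umat l A \<in> carrier_mat (2*l) (2*l)"
  and dim_Tmat [simp]: "dim_row (Tmat l t) = 2*l" "dim_col (Tmat l t) = 2*l"
  and dim_Umat [simp]: "dim_row (Umat l A) = 2*l" "dim_col (Umat l A) = 2*l"
  by (simp_all add: Tmat_def Umat_def)

text \<open>Two signs cancel: each block is antisymmetric, and block (j,i) is minus block
  (i,j).\<close>

lemma Tmat_symmetric:
  "a < 2*l \<Longrightarrow> b < 2*l \<Longrightarrow> Tmat l t $$ (a,b) = Tmat l t $$ (b,a)"
  by (cases "a div 2" "b div 2" rule: linorder_cases) (simp_all add: Tmat_def blk_def)

lemma Tmat_cnj: "map_mat cnj (Tmat l t) = Tmat l (\<lambda>i j. cnj (t i j))"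
  by (rule eq_matI) (auto simp: Tmat_def blk_def)

text \<open>Blocks (i,j) and (j,i) contribute equally, which cancels 1/2. The vector
  \<open>z\<close> is arbitrary so that it can be the variables or their images under the
  action.\<close>

lemma Tmat_quadratic_form:
  fixes z :: "nat \<Rightarrow> cpoly"
  shows "Const (1/2) * (\<Sum>c<2*l. \<Sum>d<2*l. Const (Tmat l t $$ (c,d)) * (z c * z d)) =
    (\<Sum>(i,j)\<in>pairs l. Const (t i j) * (z (2*i) * z (2*j+1) - z (2*i+1) * z (2*j)))"
    (is "_ = ?R")
proof -
  define h where "h i j = Const (t i j) * (z (2*i) * z (2*j+1) - z (2*i+1) * z (2*j))" for i j
  have T: "Const (Tmat l t $$ (2*i,2*j)) * (z (2*i) * z (2*j)) +
      Const (Tmat l t $$ (2*i,2*j+1)) * (z (2*i) * z (2*j+1)) +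
      (Const (Tmat l t $$ (2*i+1,2*j)) * (z (2*i+1) * z (2*j)) +
      Const (Tmat l t $$ (2*i+1,2*j+1)) * (z (2*i+1) * z (2*j+1))) =
      (if i < j then h i j else if j < i then h j i else 0)" if "i < l" "j < l" for i j
    using that by (auto simp: Tmat_def blk_def h_def Const_uminus algebra_simps)
  have "(\<Sum>c<2*l. \<Sum>d<2*l. Const (Tmat l t $$ (c,d)) * (z c * z d)) =
      (\<Sum>i<l. \<Sum>j<l. if i < j then h i j else if j < i then h j i else 0)"
    unfolding sum_lessThan_double sum.distrib[symmetric]
    by (intro sum.cong refl) (simp only: lessThan_iff T)
  also have "\<dots> = ?R + ?R"
    by (simp only: sum_pairs h_def)
  finally have "Const (1/2) * (\<Sum>c<2*l. \<Sum>d<2*l. Const (Tmat l t $$ (c,d)) * (z c * z d)) =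
      (Const (1/2) + Const (1/2)) * ?R"
    by (simp only: distrib_left distrib_right)
  moreover have "Const (1/2) + Const (1/2) = 1"
    unfolding Const_add[symmetric] by simp
  ultimately show ?thesis by (simp only: mult_1_left)
qed

lemma quad_form_Tmat:
  "quad_form (2*l) coord (Tmat l t) = (\<Sum>(i,j)\<in>pairs l. Const (t i j) * xi i j)"
  by (simp only: quad_form_def Tmat_quadratic_form xi_def coord_double)

text \<open>In flat coordinates the action is right multiplication of the row vector u by the block
  diagonal matrix \<open>Umat l A\<close>.\<close>

lemma Tact_Var:
  assumes "c < 2*l"
  shows "Tact A (Var (coord c)) = (\<Sum>a<2*l. Const (Umat l A $$ (a,c)) * Var (coord a))"
proof -
  have two: "(\<Sum>m<2. f m) = f 0 + f 1" for f :: "nat \<Rightarrow> cpoly"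
    by (simp add: numeral_2_eq_2)
  have "(\<Sum>a<2*l. Const (Umat l A $$ (a,c)) * Var (coord a)) =
      (\<Sum>i<l. if i = c div 2 then (\<Sum>m<2. Const (A i $$ (m, c mod 2)) * Var (i,m)) else 0)"
    unfolding sum_lessThan_double
    using assms by (intro sum.cong refl) (auto simp: Umat_def two)
  also have "\<dots> = (\<Sum>m<2. Const (A (c div 2) $$ (m, c mod 2)) * Var (c div 2,m))"
    using assms by (subst sum.delta) auto
  finally show ?thesis
    by (simp add: Tact_def subst_Var coord_def)
qed

lemma Tact_xi:
  "Tact A (xi i j) = Tact A (Var (i,0)) * Tact A (Var (j,1)) - Tact A (Var (i,1)) * Tact A (Var (j,0))"
  by (simp add: Tact_def xi_def subst_diff subst_mult)

text \<open>Since \<open>u (U T U^t) u^t = (u U) T (u U)^t\<close> and \<open>u U\<close> lists the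
  images of the variables, \<open>Tmat_quadratic_form\<close> applies with these images as
  \<open>z\<close>.\<close>

lemma quad_form_Umat:
  "quad_form (2*l) coord (Umat l A * Tmat l t * transpose_mat (Umat l A)) =
     (\<Sum>(i,j)\<in>pairs l. Const (t i j) * Tact A (xi i j))"
proof -
  define U where "U = Umat l A"
  define T where "T = Tmat l t"
  define n where "n = 2*l"
  have U: "U \<in> carrier_mat n n" and T: "T \<in> carrier_mat n n"
    by (simp_all add: U_def T_def n_def)
  have entry: "(U * T * transpose_mat U) $$ (a,b) =
      (\<Sum>c<n. \<Sum>d<n. T $$ (c,d) * U $$ (a,c) * U $$ (b,d))" if "a < n" "b < n" for a b
    using that U T
    by (simp add: scalar_prod_def lessThan_atLeast0 sum_distrib_left mult_ac)
  define X where "X a b c d = Const (T $$ (c,d)) * (Const (U $$ (a,c)) * Var (coord a) *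
      (Const (U $$ (b,d)) * Var (coord b)))" for a b c d
  have "(\<Sum>a<n. \<Sum>b<n. Const ((U * T * transpose_mat U) $$ (a,b)) * (Var (coord a) * Var (coord b))) =
      (\<Sum>a<n. \<Sum>b<n. \<Sum>c<n. \<Sum>d<n. X a b c d)"
    by (intro sum.cong refl)
       (simp add: entry Const_sum Const_mult sum_distrib_left sum_distrib_right X_def mult_ac)
  \<comment> \<open>With c and d outermost, the sums over a and b factor into the images of two
    variables.\<close>
  also have "\<dots> = (\<Sum>c<n. \<Sum>d<n. \<Sum>a<n. \<Sum>b<n. X a b c d)"
  proof -
    have rot: "(\<Sum>b<n. \<Sum>c<n. \<Sum>d<n. Y b c d) = (\<Sum>c<n. \<Sum>d<n. \<Sum>b<n. Y b c d)"
      for Y :: "nat \<Rightarrow> nat \<Rightarrow> nat \<Rightarrow> cpoly"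
      by (rule trans[OF sum.swap]) (rule sum.cong[OF refl], rule sum.swap)
    show ?thesis by (simp only: rot[of "X _"] rot[of "\<lambda>a c d. \<Sum>b<n. X a b c d"])
  qed
  also have "\<dots> = (\<Sum>c<n. \<Sum>d<n. Const (T $$ (c,d)) * (Tact A (Var (coord c)) * Tact A (Var (coord d))))"
  proof (intro sum.cong refl)
    have z: "Tact A (Var (coord c)) = (\<Sum>a<n. Const (U $$ (a,c)) * Var (coord a))" if "c < n" for c
      using that by (simp add: Tact_Var[of c l] n_def U_def)
    fix c d assume "c \<in> {..<n}" "d \<in> {..<n}"
    then show "(\<Sum>a<n. \<Sum>b<n. X a b c d) =
        Const (T $$ (c,d)) * (Tact A (Var (coord c)) * Tact A (Var (coord d)))"
      by (simp only: lessThan_iff z sum_product) (simp only: sum_distrib_left X_def)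
  qed
  finally have "quad_form n coord (U * T * transpose_mat U) =
      (\<Sum>(i,j)\<in>pairs l. Const (t i j) * Tact A (xi i j))"
    unfolding quad_form_def n_def T_def
    by (simp only: Tmat_quadratic_form coord_double Tact_xi)
  then show ?thesis by (simp add: n_def U_def T_def)
qed

lemma Umat_Tmat_symmetric:
  fixes l :: nat and A :: "nat \<Rightarrow> complex mat" and t :: "nat \<Rightarrow> nat \<Rightarrow> complex"
  defines "S \<equiv> Umat l A * Tmat l t * transpose_mat (Umat l A)"
  assumes "a < 2*l" "b < 2*l"
  shows "S $$ (a,b) = S $$ (b,a)"
proof -
  let ?U = "Umat l A" and ?T = "Tmat l t"
  have "transpose_mat ?T = ?T"
    by (rule eq_matI) (simp_all add: Tmat_symmetric)
  then have "transpose_mat (?U * ?T) = ?T * transpose_mat ?U"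
    by (simp add: transpose_mult[OF Umat_carrier Tmat_carrier])
  moreover have "transpose_mat S = transpose_mat (transpose_mat ?U) * transpose_mat (?U * ?T)"
    unfolding S_def by (rule transpose_mult[of _ "2*l" "2*l" _ "2*l"])
      (simp_all add: mult_carrier_mat[OF Umat_carrier Tmat_carrier])
  ultimately have "transpose_mat S = S"
    unfolding S_def
    by (simp add: assoc_mult_mat[of _ "2*l" "2*l" _ "2*l" _ "2*l"])
  moreover have "transpose_mat S $$ (b,a) = S $$ (a,b)"
    using assms(2,3) unfolding S_def by (intro index_transpose_mat) simp_all
  ultimately show ?thesis by simp
qed

subsection \<open>Expansion of the powers of a quadratic form\<close>

text \<open>The finite slice of matrices for which \<open>Xi l \<alpha>\<close> has total degree 2k;
  it indexes the expansion of the k-th power of the quadratic form.\<close>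

definition sym_mats_deg :: "nat \<Rightarrow> nat \<Rightarrow> (nat \<Rightarrow> nat \<Rightarrow> nat) set" where
  "sym_mats_deg l k = {\<alpha> \<in> sym_mats l. (\<Sum>(i,j)\<in>pairs l. \<alpha> i j) = k}"

lemma bij_betw_sym_mats_deg:
  "bij_betw (\<lambda>a i j. if i < j then a (i,j) else if j < i then a (j,i) else 0)
     (compositions (pairs l) k) (sym_mats_deg l k)"
proof (rule bij_betw_byWitness[where f' = "\<lambda>\<alpha> (i,j). if i < j \<and> j < l then \<alpha> i j else 0"])
  let ?f = "\<lambda>a i j. if i < j then a (i,j) else if j < i then a (j,i) else (0::nat)"
  let ?g = "\<lambda>\<alpha> (i,j). if i < j \<and> j < l then \<alpha> i j else (0::nat)"
  show "\<forall>a\<in>compositions (pairs l) k. ?g (?f a) = a"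
    by (auto simp: compositions_def fun_eq_iff)
  show "\<forall>\<alpha>\<in>sym_mats_deg l k. ?f (?g \<alpha>) = \<alpha>"
    by (auto simp: sym_mats_deg_def sym_mats_def fun_eq_iff not_less)
  show "?f ` compositions (pairs l) k \<subseteq> sym_mats_deg l k"
  proof (intro subsetI, elim imageE, hypsubst)
    fix a assume a: "a \<in> compositions (pairs l) k"
    have "(\<Sum>(i,j)\<in>pairs l. ?f a i j) = sum a (pairs l)"
      by (rule sum.cong) auto
    with a show "?f a \<in> sym_mats_deg l k"
      by (auto simp: sym_mats_deg_def sym_mats_def compositions_def)
  qed
  show "?g ` sym_mats_deg l k \<subseteq> compositions (pairs l) k"
  proof (intro subsetI, elim imageE, hypsubst)
    fix \<alpha> assume \<alpha>: "\<alpha> \<in> sym_mats_deg l k"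
    have "sum (?g \<alpha>) (pairs l) = (\<Sum>(i,j)\<in>pairs l. \<alpha> i j)"
      by (rule sum.cong) auto
    with \<alpha> show "?g \<alpha> \<in> compositions (pairs l) k"
      by (auto simp: sym_mats_deg_def compositions_def)
  qed
qed

lemma finite_sym_mats_deg: "finite (sym_mats_deg l k)"
  using bij_betw_finite[OF bij_betw_sym_mats_deg] finite_compositions[OF finite_pairs] by blast

lemma multinomial_sym_mats:
  fixes x :: "nat \<Rightarrow> nat \<Rightarrow> 'a::comm_ring_1" and c :: "nat \<Rightarrow> 'a"
  assumes "\<And>k. of_nat (fact k) * c k = 1"
  shows "c k * (\<Sum>(i,j)\<in>pairs l. x i j) ^ k =
    (\<Sum>\<alpha>\<in>sym_mats_deg l k. \<Prod>(i,j)\<in>pairs l. c (\<alpha> i j) * x i j ^ \<alpha> i j)"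
proof -
  have "c k * (\<Sum>(i,j)\<in>pairs l. x i j) ^ k =
      (\<Sum>a\<in>compositions (pairs l) k. \<Prod>p\<in>pairs l. c (a p) * (case p of (i,j) \<Rightarrow> x i j) ^ a p)"
    by (rule multinomial_divided_powers[OF assms finite_pairs])
  also have "\<dots> = (\<Sum>\<alpha>\<in>sym_mats_deg l k. \<Prod>(i,j)\<in>pairs l. c (\<alpha> i j) * x i j ^ \<alpha> i j)"
    unfolding sum.reindex_bij_betw[OF bij_betw_sym_mats_deg, symmetric]
    by (intro sum.cong prod.cong refl) auto
  finally show ?thesis .
qed

text \<open>With \<open>y\<close> equal to \<open>xi\<close> or to its image under the action, this
  is the generating function of the \<open>Xi l \<alpha>\<close> in degree 2k.\<close>

lemma divided_power_expand:
  fixes y :: "nat \<Rightarrow> nat \<Rightarrow> cpoly"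
  shows "Const (1 / fact k) * (\<Sum>(i,j)\<in>pairs l. Const (t i j) * y i j) ^ k =
    (\<Sum>\<alpha>\<in>sym_mats_deg l k. Const (\<Prod>(i,j)\<in>pairs l. t i j ^ \<alpha> i j / fact (\<alpha> i j)) *
      (\<Prod>(i,j)\<in>pairs l. y i j ^ \<alpha> i j))"
proof -
  have "of_nat (fact k) * Const (1 / fact k) = 1" for k
    unfolding Const_of_nat[symmetric] Const_mult[symmetric] by simp
  note expand = multinomial_sym_mats[OF this, of k "\<lambda>i j. Const (t i j) * y i j" l]
  have "(\<Prod>(i,j)\<in>pairs l. Const (1 / fact (\<alpha> i j)) * (Const (t i j) * y i j) ^ \<alpha> i j) =
      Const (\<Prod>(i,j)\<in>pairs l. t i j ^ \<alpha> i j / fact (\<alpha> i j)) *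
      (\<Prod>(i,j)\<in>pairs l. y i j ^ \<alpha> i j)" for \<alpha> :: "nat \<Rightarrow> nat \<Rightarrow> nat"
    unfolding Const_prod prod.distrib[symmetric]
    by (intro prod.cong refl)
       (auto simp: power_mult_distrib Const_mult[symmetric] Const_power[symmetric] mult.assoc[symmetric])
  then show ?thesis by (simp only: expand)
qed

subsection \<open>Homogeneity and size of the invariants\<close>

lemma Tact_Xi: "Tact A (Xi l \<alpha>) = (\<Prod>(i,j)\<in>pairs l. Tact A (xi i j) ^ \<alpha> i j)"
  unfolding Tact_def Xi_def subst_prod
  by (rule prod.cong) (auto simp: subst_power)

context
  fixes w :: "mono \<Rightarrow> nat" and d :: "nat \<Rightarrow> nat"
  assumes w_0: "w 0 = 0" and w_add: "\<And>m m'. w (m + m') = w m + w m'"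
    and w_var: "\<And>i k. k < 2 \<Longrightarrow> w (Poly_Mapping.single (i,k) 1) = d i"
begin

text \<open>The action mixes only the two coordinates of one \<open>u_i\<close>, which both have
  weight \<open>d i\<close>, so it preserves the grading.\<close>

lemma homogeneous_Tact_Var: "homogeneous w (d i) (Tact A (Var (i,k)))"
proof -
  have "homogeneous w (0 + w (Poly_Mapping.single (i,m) 1)) (Const c * Var (i,m))" for m c
    by (intro homogeneous_mult w_0 w_add homogeneous_Const homogeneous_Var)
  then have "homogeneous w (d i) (\<Sum>m<2. Const (A i $$ (m,k)) * Var (i,m))"
    by (intro homogeneous_sum) (metis add_0 lessThan_iff w_var)
  then show ?thesis by (simp add: Tact_def subst_Var)
qed

lemma homogeneous_xi: "homogeneous w (d i + d j) (xi i j)"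
proof -
  have "homogeneous w (d i) (Var (i,k))" if "k < 2" for i k
    using homogeneous_Var[of w "(i,k)"] that by (simp only: w_var)
  then show ?thesis
    unfolding xi_def by (intro homogeneous_diff homogeneous_mult w_0 w_add) auto
qed

lemma homogeneous_Tact_xi: "homogeneous w (d i + d j) (Tact A (xi i j))"
  unfolding Tact_xi by (intro homogeneous_diff homogeneous_mult w_0 w_add homogeneous_Tact_Var)

lemma homogeneous_Xi:
  "homogeneous w (\<Sum>(i,j)\<in>pairs l. \<alpha> i j * (d i + d j)) (Xi l \<alpha>)"
  unfolding Xi_def
  by (intro homogeneous_prod w_0 w_add)
     (auto intro!: homogeneous_power w_0 w_add homogeneous_xi)

lemma homogeneous_Tact_Xi:
  "homogeneous w (\<Sum>(i,j)\<in>pairs l. \<alpha> i j * (d i + d j)) (Tact A (Xi l \<alpha>))"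
  unfolding Tact_Xi
  by (intro homogeneous_prod w_0 w_add)
     (auto intro!: homogeneous_power w_0 w_add homogeneous_Tact_xi)

end

text \<open>The left side is the degree of \<open>Xi l \<alpha>\<close> in \<open>u_r\<close>: each
  factor \<open>xi i j\<close> contains \<open>u_r\<close> once if r is i or j.\<close>

lemma sum_pairs_row_sum:
  assumes "\<alpha> \<in> sym_mats l" "r < l"
  shows "(\<Sum>(i,j)\<in>pairs l. \<alpha> i j * ((if i = r then 1 else 0) + (if j = r then 1 else 0))) =
    row_sum l \<alpha> r"
proof -
  have sym: "\<alpha> i j = \<alpha> j i" "\<alpha> i i = 0" for i j
    using assms(1) by (auto simp: sym_mats_def)
  \<comment> \<open>Doubling extends the sum to the full square, where each delta can be summed
    out.\<close>
  have "2 * (\<Sum>(i,j)\<in>pairs l. \<alpha> i j * ((if i = r then 1 else 0) + (if j = r then 1 else 0))) =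
      (\<Sum>i<l. \<Sum>j<l. \<alpha> i j * ((if i = r then 1 else 0) + (if j = r then 1 else 0)))"
    by (rule sum_pairs_symmetric[symmetric]) (simp_all add: sym(2) sym(1)[of _ j for j] add.commute)
  also have "\<dots> = (\<Sum>j<l. \<Sum>i<l. if i = r then \<alpha> i j else 0) +
      (\<Sum>i<l. \<Sum>j<l. if j = r then \<alpha> i j else 0)"
    by (subst (2) sum.swap)
       (simp add: distrib_left sum.distrib if_distrib[of "\<lambda>x. _ * x"] cong: if_cong)
  also have "\<dots> = 2 * row_sum l \<alpha> r"
    using assms(2) by (simp add: row_sum_def sym(1)[of _ r])
  finally show ?thesis by simp
qed

text \<open>The two polynomials have different degrees in \<open>u_r\<close> and hence no monomial
  in common. Terms with unequal row sums may therefore be added to the series freely.\<close>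

lemma Phi_eq_0:
  assumes "\<alpha> \<in> sym_mats l" "\<beta> \<in> sym_mats l" "r < l" "row_sum l \<alpha> r \<noteq> row_sum l \<beta> r"
  shows "Phi l \<alpha> \<beta> A = 0"
proof -
  let ?w = "\<lambda>m :: mono. Poly_Mapping.lookup m (r,0) + Poly_Mapping.lookup m (r,1)"
  let ?d = "\<lambda>i. if i = r then 1 else (0::nat)"
  have w: "?w 0 = 0" "?w (m + m') = ?w m + ?w m'" for m m'
    by (simp_all add: lookup_add)
  have var: "?w (Poly_Mapping.single (i,k) 1) = ?d i" if "k < 2" for i k
    using that by (auto simp: lookup_single when_def less_2_cases_iff)
  have "homogeneous ?w (row_sum l \<alpha> r) (Tact A (Xi l \<alpha>))"
    unfolding sum_pairs_row_sum[OF assms(1,3), symmetric]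
    by (rule homogeneous_Tact_Xi[OF w var])
  moreover have "homogeneous ?w (row_sum l \<beta> r) (Xi l \<beta>)"
    unfolding sum_pairs_row_sum[OF assms(2,3), symmetric]
    by (rule homogeneous_Xi[OF w var])
  ultimately show ?thesis
    unfolding Phi_def using assms(4) by (rule fock_inner_homogeneous_eq_0)
qed

lemma coeff_norm_prod_power_le:
  assumes "\<alpha> \<in> sym_mats_deg l k" and "\<And>i j. (i,j) \<in> pairs l \<Longrightarrow> coeff_norm (y i j) \<le> C"
  shows "coeff_norm (\<Prod>(i,j)\<in>pairs l. y i j ^ \<alpha> i j) \<le> C ^ k"
proof -
  have "coeff_norm (\<Prod>(i,j)\<in>pairs l. y i j ^ \<alpha> i j) \<le>
      (\<Prod>p\<in>pairs l. coeff_norm (case p of (i,j) \<Rightarrow> y i j ^ \<alpha> i j))"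
    by (rule coeff_norm_prod)
  also have "\<dots> \<le> (\<Prod>p\<in>pairs l. C ^ (case p of (i,j) \<Rightarrow> \<alpha> i j))"
  proof (intro prod_mono conjI)
    fix p assume "p \<in> pairs l"
    then obtain i j where p: "p = (i,j)" "(i,j) \<in> pairs l" by auto
    have "coeff_norm (y i j ^ \<alpha> i j) \<le> coeff_norm (y i j) ^ \<alpha> i j"
      by (rule coeff_norm_power)
    also have "\<dots> \<le> C ^ \<alpha> i j"
      using assms(2)[OF p(2)] by (intro power_mono) auto
    finally show "coeff_norm (case p of (i,j) \<Rightarrow> y i j ^ \<alpha> i j) \<le> C ^ (case p of (i,j) \<Rightarrow> \<alpha> i j)"
      using p by simp
  qed auto
  also have "\<dots> = C ^ k"
    using assms(1) by (simp add: power_sum[symmetric] sym_mats_deg_def)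
  finally show ?thesis .
qed

text \<open>Both polynomials are products of k factors of norm at most \<open>C\<close>, and their
  total degree is 2k.\<close>

lemma norm_Phi_le:
  assumes \<alpha>: "\<alpha> \<in> sym_mats_deg l k" and \<beta>: "\<beta> \<in> sym_mats_deg l k"
    and C: "\<And>i j. (i,j) \<in> pairs l \<Longrightarrow> coeff_norm (xi i j) \<le> C"
      "\<And>i j. (i,j) \<in> pairs l \<Longrightarrow> coeff_norm (Tact A (xi i j)) \<le> C"
  shows "cmod (Phi l \<alpha> \<beta> A) \<le> fact (2*k) * C ^ k * C ^ k"
proof -
  have "homogeneous total_degree (\<Sum>(i,j)\<in>pairs l. \<alpha> i j * (1 + 1)) (Tact A (Xi l \<alpha>))"
    by (rule homogeneous_Tact_Xi) (simp_all add: total_degree_0 total_degree_add, simp add: total_degree_def)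
  also have "(\<Sum>(i,j)\<in>pairs l. \<alpha> i j * (1 + 1)) = 2*k"
    using \<alpha> by (simp add: sym_mats_deg_def case_prod_unfold flip: sum_distrib_right)
  finally have "cmod (Phi l \<alpha> \<beta> A) \<le> fact (2*k) * coeff_norm (Tact A (Xi l \<alpha>)) * coeff_norm (Xi l \<beta>)"
    unfolding Phi_def by (rule norm_fock_inner_le)
  moreover have X: "coeff_norm (Tact A (Xi l \<alpha>)) \<le> C ^ k"
    unfolding Tact_Xi by (rule coeff_norm_prod_power_le[OF \<alpha> C(2)])
  moreover have "coeff_norm (Xi l \<beta>) \<le> C ^ k"
    unfolding Xi_def by (rule coeff_norm_prod_power_le[OF \<beta> C(1)])
  moreover have "0 \<le> C ^ k"
    using X coeff_norm_nonneg order_trans by blast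
  ultimately show ?thesis
    by (smt (verit, best) coeff_norm_nonneg fact_ge_zero mult_left_mono mult_mono
      mult_nonneg_nonneg)
qed

section \<open>Terms of the generating series and their absolute convergence\<close>

definition gen_term :: "nat \<Rightarrow> (nat \<Rightarrow> complex mat) \<Rightarrow> (nat \<Rightarrow> nat \<Rightarrow> complex) \<Rightarrow>
    (nat \<Rightarrow> nat \<Rightarrow> complex) \<Rightarrow> (nat \<Rightarrow> nat \<Rightarrow> nat) \<Rightarrow> (nat \<Rightarrow> nat \<Rightarrow> nat) \<Rightarrow> complex" where
  "gen_term l A t t' \<alpha> \<beta> = (\<Prod>(i,j)\<in>pairs l.
     t i j ^ \<alpha> i j * cnj (t' i j) ^ \<beta> i j / (fact (\<alpha> i j) * fact (\<beta> i j))) * Phi l \<alpha> \<beta> A"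

lemma gen_term_eq:
  "gen_term l A t t' \<alpha> \<beta> = (\<Prod>(i,j)\<in>pairs l. t i j ^ \<alpha> i j / fact (\<alpha> i j)) *
     cnj (\<Prod>(i,j)\<in>pairs l. t' i j ^ \<beta> i j / fact (\<beta> i j)) * Phi l \<alpha> \<beta> A"
proof -
  have "cnj (\<Prod>(i,j)\<in>pairs l. t' i j ^ \<beta> i j / fact (\<beta> i j)) =
      (\<Prod>(i,j)\<in>pairs l. cnj (t' i j) ^ \<beta> i j / fact (\<beta> i j))"
    unfolding cnj_prod by (rule prod.cong) auto
  moreover have "(\<Prod>(i,j)\<in>pairs l. t i j ^ \<alpha> i j / fact (\<alpha> i j)) *
      (\<Prod>(i,j)\<in>pairs l. cnj (t' i j) ^ \<beta> i j / fact (\<beta> i j)) = (\<Prod>(i,j)\<in>pairs l.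
      t i j ^ \<alpha> i j * cnj (t' i j) ^ \<beta> i j / (fact (\<alpha> i j) * fact (\<beta> i j)))"
    unfolding prod.distrib[symmetric] by (rule prod.cong) auto
  ultimately show ?thesis by (simp add: gen_term_def)
qed

text \<open>Both exponentials are expanded over the same slice and paired sesquilinearly; pairs with
  unequal row sums are included.\<close>

lemma fock_inner_quad_exp:
  "fock_inner (quad_exp (2*l) coord (Umat l A * Tmat l t * transpose_mat (Umat l A)) k)
     (quad_exp (2*l) coord (Tmat l t') k) =
   (\<Sum>(\<alpha>,\<beta>)\<in>sym_mats_deg l k \<times> sym_mats_deg l k. gen_term l A t t' \<alpha> \<beta>)"
proof -
  have "quad_exp (2*l) coord (Umat l A * Tmat l t * transpose_mat (Umat l A)) k =
      (\<Sum>\<alpha>\<in>sym_mats_deg l k. Const (\<Prod>(i,j)\<in>pairs l. t i j ^ \<alpha> i j / fact (\<alpha> i j)) * Tact A (Xi l \<alpha>))"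
    by (simp only: quad_exp_def quad_form_Umat divided_power_expand Tact_Xi)
  moreover have "quad_exp (2*l) coord (Tmat l t') k =
      (\<Sum>\<beta>\<in>sym_mats_deg l k. Const (\<Prod>(i,j)\<in>pairs l. t' i j ^ \<beta> i j / fact (\<beta> i j)) * Xi l \<beta>)"
    by (simp only: quad_exp_def quad_form_Tmat divided_power_expand Xi_def)
  ultimately show ?thesis
    by (simp only: fock_inner_sum_left fock_inner_Const_left)
       (simp only: fock_inner_sum_right fock_inner_Const_right sum_distrib_left
          Phi_def[symmetric] gen_term_eq sum.cartesian_product[symmetric] mult.assoc)
qed

text \<open>The growth (2k)! of the inner products is balanced by a factor 1/k! from each of the
  sums over \<open>\<alpha>\<close> and \<open>\<beta>\<close>. What remains is a central binomial
  coefficient, at most 4^k, so the bound is geometric.\<close>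

lemma norm_gen_term_sum_le:
  fixes \<epsilon> C :: real
  assumes t: "\<And>i j. (i,j) \<in> pairs l \<Longrightarrow> cmod (t i j) \<le> \<epsilon>"
      "\<And>i j. (i,j) \<in> pairs l \<Longrightarrow> cmod (t' i j) \<le> \<epsilon>"
    and C: "\<And>i j. (i,j) \<in> pairs l \<Longrightarrow> coeff_norm (xi i j) \<le> C"
      "\<And>i j. (i,j) \<in> pairs l \<Longrightarrow> coeff_norm (Tact A (xi i j)) \<le> C"
    and C0: "0 \<le> C"
  shows "(\<Sum>(\<alpha>,\<beta>)\<in>sym_mats_deg l k \<times> sym_mats_deg l k. cmod (gen_term l A t t' \<alpha> \<beta>)) \<le>
    ((2 * real (card (pairs l)) * C * \<epsilon>) ^ 2) ^ k"
proof -
  define e where "e \<alpha> = (\<Prod>(i,j)\<in>pairs l. 1 / fact (\<alpha> i j) * \<epsilon> ^ \<alpha> i j)" for \<alpha>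
  define N where "N = real (card (pairs l))"
  have le_e: "cmod (\<Prod>(i,j)\<in>pairs l. s i j ^ \<alpha> i j / fact (\<alpha> i j)) \<le> e \<alpha>"
    if "\<And>i j. (i,j) \<in> pairs l \<Longrightarrow> cmod (s i j) \<le> \<epsilon>" for s and \<alpha> :: "nat \<Rightarrow> nat \<Rightarrow> nat"
    unfolding e_def prod_norm[symmetric]
    using that by (intro prod_mono) (auto simp: norm_divide norm_power divide_right_mono power_mono)
  have e_nonneg: "0 \<le> e \<alpha>" for \<alpha>
    using le_e[of t] t(1) norm_ge_zero order_trans by blast
  \<comment> \<open>This is the multinomial theorem with every variable equal to
    \<open>\<epsilon>\<close>.\<close>
  have e_sum: "(\<Sum>\<alpha>\<in>sym_mats_deg l k. e \<alpha>) = (N * \<epsilon>) ^ k / fact k"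
    unfolding e_def
    using multinomial_sym_mats[of "\<lambda>k. 1 / fact k :: real" k "\<lambda>i j. \<epsilon>" l]
    by (simp add: N_def case_prod_unfold)
  have "cmod (gen_term l A t t' \<alpha> \<beta>) \<le> e \<alpha> * e \<beta> * (fact (2*k) * C ^ k * C ^ k)"
    if "\<alpha> \<in> sym_mats_deg l k" "\<beta> \<in> sym_mats_deg l k" for \<alpha> \<beta>
    unfolding gen_term_eq norm_mult complex_mod_cnj
    by (intro mult_mono le_e t norm_Phi_le[OF that C] mult_nonneg_nonneg e_nonneg norm_ge_zero)
  then have "(\<Sum>(\<alpha>,\<beta>)\<in>sym_mats_deg l k \<times> sym_mats_deg l k. cmod (gen_term l A t t' \<alpha> \<beta>)) \<le>
      (\<Sum>(\<alpha>,\<beta>)\<in>sym_mats_deg l k \<times> sym_mats_deg l k. e \<alpha> * e \<beta> * (fact (2*k) * C ^ k * C ^ k))"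
    by (intro sum_mono) auto
  also have "\<dots> = (\<Sum>(\<alpha>,\<beta>)\<in>sym_mats_deg l k \<times> sym_mats_deg l k. e \<alpha> * e \<beta>) *
      (fact (2*k) * C ^ k * C ^ k)"
    by (simp add: sum_distrib_right case_prod_unfold)
  also have "(\<Sum>(\<alpha>,\<beta>)\<in>sym_mats_deg l k \<times> sym_mats_deg l k. e \<alpha> * e \<beta>) =
      ((N * \<epsilon>) ^ k / fact k) * ((N * \<epsilon>) ^ k / fact k)"
    unfolding e_sum[symmetric] by (simp add: sum_product sum.cartesian_product)
  also have "(N * \<epsilon>) ^ k / fact k * ((N * \<epsilon>) ^ k / fact k) * (fact (2*k) * C ^ k * C ^ k) =
      (fact (2*k) / (fact k * fact k)) * ((N * C * \<epsilon>) ^ 2) ^ k"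
    by (simp add: power_mult_distrib power2_eq_square field_simps)
  also have "fact (2*k) / (fact k * fact k) = real ((2*k) choose k)"
    by (simp add: binomial_fact mult_2)
  also have "real ((2*k) choose k) * ((N * C * \<epsilon>) ^ 2) ^ k \<le> 2 ^ (2*k) * ((N * C * \<epsilon>) ^ 2) ^ k"
  proof (rule mult_right_mono)
    have "(2*k) choose k \<le> 2 ^ (2*k)" by (rule binomial_le_pow2)
    then show "real ((2*k) choose k) \<le> 2 ^ (2*k)"
      by (metis of_nat_le_iff of_nat_numeral of_nat_power)
  qed simp
  also have "\<dots> = ((2 * N * C * \<epsilon>) ^ 2) ^ k"
    by (simp add: power_mult power_mult_distrib mult.assoc)
  finally show ?thesis by (simp add: N_def)
qed

section \<open>Evaluation at 1 and the branch of the square root\<close>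

lemma sums_inverse_csqrt:
  fixes g :: "nat \<Rightarrow> complex"
  assumes bound: "\<And>k. cmod (g k) \<le> (1/4) ^ k" and g0: "g 0 = 1"
    and eq: "Abs_fps g ^ 2 * fps_of_poly p = 1"
  shows "g sums inverse (csqrt (poly p 1))"
proof -
  define G where "G = Abs_fps g"
  \<comment> \<open>Convergence at 2 puts the point 1 strictly inside the disc of convergence, where
    the formal identity may be evaluated.\<close>
  have "summable (\<lambda>k. g k * 2 ^ k)"
  proof (rule summable_comparison_test', rule summable_geometric[of "1/2::real"])
    show "norm (g k * 2 ^ k) \<le> (1/2) ^ k" for k
    proof -
      have "norm (g k * 2 ^ k) \<le> (1/4) ^ k * 2 ^ k"
        using bound[of k] by (simp add: norm_mult norm_power)
      also have "\<dots> = (1/2) ^ k"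
        by (simp flip: power_mult_distrib)
      finally show ?thesis .
    qed
  qed simp
  then have "norm (2::complex) \<le> conv_radius g"
    by (rule conv_radius_geI)
  then have "ereal 2 \<le> fps_conv_radius G"
    by (simp add: fps_conv_radius_def G_def)
  then have rad: "ereal (norm (1::complex)) < fps_conv_radius G"
    by (rule less_le_trans[rotated]) simp
  define s where "s = eval_fps G 1"
  have sums: "g sums s"
    using sums_eval_fps[OF rad] by (simp add: s_def G_def)
  have "eval_fps (G ^ 2 * fps_of_poly p) 1 = eval_fps (G ^ 2) 1 * eval_fps (fps_of_poly p) 1"
    by (rule eval_fps_mult) (use rad fps_conv_radius_power[of G 2] in \<open>auto intro: less_le_trans\<close>)
  then have sq: "s ^ 2 * poly p 1 = 1"
    using eq[folded G_def] by (simp add: eval_fps_power[OF rad] s_def)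
  \<comment> \<open>The tail is at most 1/4 + 1/16 + ... = 1/3, which keeps \<open>s\<close> in the
    right half plane.\<close>
  have "s - 1 = suminf (\<lambda>k. g (Suc k))"
    using suminf_split_head[of g] sums g0 by (simp add: sums_iff)
  also have "cmod \<dots> \<le> suminf (\<lambda>k. (1/4) ^ Suc k)"
    by (rule norm_suminf_le[OF bound]) (simp add: summable_mult summable_geometric)
  also have "\<dots> = 1/3"
    using suminf_split_head[of "\<lambda>k. (1/4::real) ^ k"] by (simp add: suminf_geometric)
  finally have "\<bar>Re (s - 1)\<bar> \<le> 1/3"
    using abs_Re_le_cmod order_trans by blast
  then have Re: "0 < Re s"
    unfolding minus_complex.sel one_complex.sel by linarith
  then have s0: "s \<noteq> 0" by auto
  \<comment> \<open>Inversion preserves the right half plane, so \<open>inverse s\<close> is the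
    principal root.\<close>
  have "csqrt (poly p 1) = inverse s"
  proof (rule csqrt_unique)
    show "(inverse s)\<^sup>2 = poly p 1"
      using sq s0 by (simp add: field_simps power2_eq_square)
    show "0 < Re (inverse s) \<or> Re (inverse s) = 0 \<and> 0 \<le> Im (inverse s)"
      using Re by (simp add: sum_power2_gt_zero_iff)
  qed
  then show ?thesis using sums by simp
qed

section \<open>Assembling the series over all pairs of matrices\<close>

theorem theorem4p1:
  fixes l :: nat and A :: "nat \<Rightarrow> complex mat"
  assumes "l \<ge> 2"
    and "\<And>j. j < l \<Longrightarrow> SU2 (A j)"
  shows "\<exists>\<epsilon>>0. \<forall>t t' :: nat \<Rightarrow> nat \<Rightarrow> complex.
     (\<forall>i j. i < j \<and> j < l \<longrightarrow> cmod (t i j) < \<epsilon> \<and> cmod (t' i j) < \<epsilon>) \<longrightarrow>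
     ((\<lambda>(\<alpha>, \<beta>). (\<Prod>(i,j)\<in>{(i,j). i < j \<and> j < l}.
            t i j ^ \<alpha> i j * cnj (t' i j) ^ \<beta> i j / (fact (\<alpha> i j) * fact (\<beta> i j)))
          * Phi l \<alpha> \<beta> A)
      has_sum inverse (csqrt (det (1\<^sub>m (2*l) -
          Umat l A * Tmat l t * transpose_mat (Umat l A) * Tmat l (\<lambda>i j. cnj (t' i j))))))
     {(\<alpha>, \<beta>). \<alpha> \<in> sym_mats l \<and> \<beta> \<in> sym_mats l \<and>
                (\<forall>i<l. row_sum l \<alpha> i = row_sum l \<beta> i)}"
proof -
  \<comment> \<open>The sum of all the norms serves as a common bound for each of them.\<close>
  define C where "C = (\<Sum>(i,j)\<in>pairs l. coeff_norm (xi i j) + coeff_norm (Tact A (xi i j)))"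
  define N where "N = real (card (pairs l))"
  \<comment> \<open>The added ones keep \<open>Q\<close> positive and above \<open>N * C\<close>;
    then \<open>2 * N * C * \<epsilon>\<close> is at most 1/2, and its square gives the ratio
    1/4.\<close>
  define Q where "Q = (N + 1) * (C + 1)"
  define \<epsilon> where "\<epsilon> = 1 / (4 * Q)"
  have C0: "0 \<le> C" unfolding C_def by (intro sum_nonneg) auto
  have C: "coeff_norm (xi i j) \<le> C" "coeff_norm (Tact A (xi i j)) \<le> C" if "(i,j) \<in> pairs l" for i j
  proof -
    have "(\<lambda>(i,j). coeff_norm (xi i j) + coeff_norm (Tact A (xi i j))) (i,j) \<le> C"
      unfolding C_def by (rule member_le_sum[OF that]) (auto simp: finite_pairs)
    then have "coeff_norm (xi i j) + coeff_norm (Tact A (xi i j)) \<le> C" by simp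
    then show "coeff_norm (xi i j) \<le> C" "coeff_norm (Tact A (xi i j)) \<le> C"
      using coeff_norm_nonneg[of "xi i j"] coeff_norm_nonneg[of "Tact A (xi i j)"] by linarith+
  qed
  have N0: "0 \<le> N" by (simp add: N_def)
  have Q: "0 < Q" using C0 N0 by (simp add: Q_def)
  have \<epsilon>: "0 < \<epsilon>" using Q by (simp add: \<epsilon>_def)
  have "N * C \<le> Q" unfolding Q_def using C0 N0 by (intro mult_mono) auto
  then have le_1: "N * C / Q \<le> 1" using Q by (simp add: divide_le_eq_1)
  have "2 * N * C * \<epsilon> = N * C / Q / 2"
    by (simp add: \<epsilon>_def mult.commute)
  also have "\<dots> \<le> 1/2"
    by (rule divide_right_mono[OF le_1]) simp
  finally have "2 * N * C * \<epsilon> \<le> 1/2" .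
  moreover have "0 \<le> 2 * N * C * \<epsilon>" using C0 N0 \<epsilon> by simp
  ultimately have "(2 * N * C * \<epsilon>) ^ 2 \<le> (1/2) ^ 2" by (intro power_mono)
  then have quarter: "(2 * N * C * \<epsilon>) ^ 2 \<le> 1/4" by (simp add: power2_eq_square)
  show ?thesis
  proof (intro exI[of _ \<epsilon>] conjI \<epsilon> allI impI)
    fix t t' :: "nat \<Rightarrow> nat \<Rightarrow> complex"
    assume "\<forall>i j. i < j \<and> j < l \<longrightarrow> cmod (t i j) < \<epsilon> \<and> cmod (t' i j) < \<epsilon>"
    then have t: "cmod (t i j) \<le> \<epsilon>" "cmod (t' i j) \<le> \<epsilon>" if "(i,j) \<in> pairs l" for i j
      using that by (auto intro: less_imp_le)
    define S where "S = Umat l A * Tmat l t * transpose_mat (Umat l A)"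
    define R where "R = Tmat l (\<lambda>i j. cnj (t' i j))"
    define F where "F = (\<lambda>(\<alpha>,\<beta>). gen_term l A t t' \<alpha> \<beta>)"
    \<comment> \<open>\<open>D k\<close> only asks for equal total degree, not for equal row sums;
      the index sets are reconciled at the end.\<close>
    define D where "D k = sym_mats_deg l k \<times> sym_mats_deg l k" for k
    define g where "g k = sum F (D k)" for k
    have finD: "finite (D k)" for k by (simp add: D_def finite_sym_mats_deg)
    have S: "S \<in> carrier_mat (2*l) (2*l)"
      by (simp add: S_def mult_carrier_mat[of _ _ "2*l"])
    have norm_F: "(\<Sum>x\<in>D k. cmod (F x)) \<le> (1/4) ^ k" for k
    proof -
      have "(\<Sum>x\<in>D k. cmod (F x)) =
          (\<Sum>(\<alpha>,\<beta>)\<in>sym_mats_deg l k \<times> sym_mats_deg l k. cmod (gen_term l A t t' \<alpha> \<beta>))"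
        unfolding D_def F_def by (rule sum.cong) auto
      also have "\<dots> \<le> ((2 * N * C * \<epsilon>) ^ 2) ^ k"
        unfolding N_def by (rule norm_gen_term_sum_le[OF t C C0])
      also have "\<dots> \<le> (1/4) ^ k"
        by (rule power_mono[OF quarter]) simp
      finally show ?thesis .
    qed
    have norm_g: "cmod (g k) \<le> (1/4) ^ k" for k
      unfolding g_def by (rule order_trans[OF norm_sum norm_F])
    have g_eq: "g k = fock_inner (quad_exp (2*l) coord S k) (quad_exp (2*l) coord (Tmat l t') k)" for k
      unfolding g_def F_def D_def S_def fock_inner_quad_exp ..
    have g0: "g 0 = 1"
      unfolding g_eq using fock_inner_single[of 0 1 0 1] by (simp add: mono_fact_def)
    obtain p where p: "det (1\<^sub>m (2*l) - fps_X \<cdot>\<^sub>m map_mat fps_const (S * R)) = fps_of_poly p"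
        "\<And>z. poly p z = det (1\<^sub>m (2*l) - z \<cdot>\<^sub>m (S * R))"
      using det_one_minus_fps_X[of "S * R" "2*l"] mult_carrier_mat[OF S, of R "2*l"]
      by (auto simp: R_def)
    have "Abs_fps g ^ 2 * fps_of_poly p = 1"
      unfolding g_eq[abs_def] p(1)[symmetric] R_def Tmat_cnj[symmetric]
      by (rule quad_exp_generating_function[OF inj_coord S Tmat_carrier])
         (simp_all only: S_def Umat_Tmat_symmetric Tmat_symmetric)
    then have "g sums inverse (csqrt (poly p 1))"
      by (intro sums_inverse_csqrt norm_g g0)
    moreover have "1 \<cdot>\<^sub>m (S * R) = S * R"
      by (rule eq_matI) auto
    ultimately have sums: "g sums inverse (csqrt (det (1\<^sub>m (2*l) - S * R)))"
      by (simp add: p(2))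
    have "summable (\<lambda>k. cmod (g k))"
      by (rule summable_comparison_test'[OF summable_geometric[of "1/4::real"], of 0]) (simp_all add: norm_g)
    then have has_sum_g: "(g has_sum inverse (csqrt (det (1\<^sub>m (2*l) - S * R)))) UNIV"
      using sums by (rule norm_summable_imp_has_sum)
    have "(\<lambda>y. norm ((\<lambda>(k,x). F x) y)) summable_on Sigma UNIV D"
      unfolding Infinite_Sum.abs_summable_on_Sigma_iff
    proof (intro conjI ballI)
      show "(\<lambda>y. norm (case (k, y) of (k, x) \<Rightarrow> F x)) summable_on D k" for k
        by (intro summable_on_finite finD)
      have "(\<lambda>k. \<Sum>x\<in>D k. cmod (F x)) summable_on UNIV"
      proof (rule norm_summable_imp_summable_on)
        show "summable (\<lambda>k. norm (\<Sum>x\<in>D k. cmod (F x)))"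
          by (rule summable_comparison_test'[OF summable_geometric[of "1/4::real"], of 0])
             (simp_all add: norm_F sum_nonneg)
      qed
      then show "(\<lambda>k. norm (\<Sum>\<^sub>\<infinity>y\<in>D k. norm (case (k, y) of (k, x) \<Rightarrow> F x))) summable_on UNIV"
        by (simp add: infsum_finite[OF finD] sum_nonneg)
    qed
    then have "(\<lambda>(k,x). F x) summable_on Sigma UNIV D"
      by (rule Infinite_Sum.abs_summable_summable)
    then have "((\<lambda>(k,x). F x) has_sum inverse (csqrt (det (1\<^sub>m (2*l) - S * R)))) (Sigma UNIV D)"
      using has_sum_g
      by (intro has_sum_SigmaI[where g = g]) (simp_all add: g_def has_sum_finite[OF finD])
    \<comment> \<open>The slices are disjoint: k is the sum of the entries of
      \<open>\<alpha>\<close> above the diagonal.\<close>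
    moreover have "inj_on snd (Sigma UNIV D)"
      by (auto simp: inj_on_def D_def sym_mats_deg_def)
    ultimately have "(F has_sum inverse (csqrt (det (1\<^sub>m (2*l) - S * R)))) (snd ` Sigma UNIV D)"
      by (simp add: has_sum_reindex comp_def case_prod_unfold)
    moreover have "(F has_sum x) (snd ` Sigma UNIV D) \<longleftrightarrow> (F has_sum x) {(\<alpha>, \<beta>). \<alpha> \<in> sym_mats l \<and>
        \<beta> \<in> sym_mats l \<and> (\<forall>i<l. row_sum l \<alpha> i = row_sum l \<beta> i)}" (is "_ \<longleftrightarrow> (F has_sum x) ?I") for x
    proof (rule has_sum_cong_neutral)
      have total: "(\<Sum>i<l. row_sum l \<alpha> i) = 2 * (\<Sum>(i,j)\<in>pairs l. \<alpha> i j)" if "\<alpha> \<in> sym_mats l" for \<alpha>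
        unfolding row_sum_def using that by (intro sum_pairs_symmetric) (auto simp: sym_mats_def)
      \<comment> \<open>No such \<open>x\<close> exists: the row sums add up to twice the slice
        number, so equal row sums put both matrices in the same slice.\<close>
      fix x assume x: "x \<in> ?I - snd ` Sigma UNIV D"
      then obtain \<alpha> \<beta> where \<alpha>\<beta>: "x = (\<alpha>,\<beta>)" "\<alpha> \<in> sym_mats l" "\<beta> \<in> sym_mats l"
          "\<forall>i<l. row_sum l \<alpha> i = row_sum l \<beta> i"
        by auto
      then have "(\<Sum>i<l. row_sum l \<alpha> i) = (\<Sum>i<l. row_sum l \<beta> i)"
        by (intro sum.cong) auto
      then have "(\<Sum>(i,j)\<in>pairs l. \<alpha> i j) = (\<Sum>(i,j)\<in>pairs l. \<beta> i j)"
        unfolding total[OF \<alpha>\<beta>(2)] total[OF \<alpha>\<beta>(3)] by linarith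
      then have "((\<Sum>(i,j)\<in>pairs l. \<alpha> i j), x) \<in> Sigma UNIV D"
        using \<alpha>\<beta> by (auto simp: D_def sym_mats_deg_def)
      then have "x \<in> snd ` Sigma UNIV D" by force
      with x show "F x = 0" by blast
    next
      \<comment> \<open>In the same slice but with different row sums, the term vanishes by
        orthogonality.\<close>
      fix x assume x: "x \<in> snd ` Sigma UNIV D - ?I"
      obtain \<alpha> \<beta> where \<alpha>\<beta>: "x = (\<alpha>,\<beta>)" by fastforce
      have sym: "\<alpha> \<in> sym_mats l" "\<beta> \<in> sym_mats l"
        using x by (auto simp: \<alpha>\<beta> D_def sym_mats_deg_def)
      moreover obtain r where "r < l" "row_sum l \<alpha> r \<noteq> row_sum l \<beta> r"
        using x sym unfolding \<alpha>\<beta> by force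
      ultimately show "F x = 0"
        using \<alpha>\<beta>
        by (simp add: F_def gen_term_def Phi_eq_0[of \<alpha> l \<beta> r])
    qed simp
    ultimately show "((\<lambda>(\<alpha>, \<beta>). (\<Prod>(i,j)\<in>{(i,j). i < j \<and> j < l}.
            t i j ^ \<alpha> i j * cnj (t' i j) ^ \<beta> i j / (fact (\<alpha> i j) * fact (\<beta> i j)))
          * Phi l \<alpha> \<beta> A)
      has_sum inverse (csqrt (det (1\<^sub>m (2*l) -
          Umat l A * Tmat l t * transpose_mat (Umat l A) * Tmat l (\<lambda>i j. cnj (t' i j))))))
     {(\<alpha>, \<beta>). \<alpha> \<in> sym_mats l \<and> \<beta> \<in> sym_mats l \<and>
                (\<forall>i<l. row_sum l \<alpha> i = row_sum l \<beta> i)}"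
      by (simp only: F_def gen_term_def S_def R_def)
  qed
qed

end
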